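(* Let $K$ be a number field of degree $3$, let $\xi\mapsto\xi^{(i)}$ ($i=1,2,3$) be the three embeddings of $K$ into $\mathbb{C}$, and let $\Sigma\subseteq\{1,2,3\}$ with $|\Sigma|\ge 2$. (i) Suppose that either $\Sigma=\{1,2,3\}$, or $K$ is totally real and $|\Sigma|=2$, or $\Sigma=\{i,j\}$ where the embeddings $\xi\mapsto\xi^{(i)}$ and $\xi\mapsto\xi^{(j)}$ are complex conjugate. Then $\kappa(\Sigma)=2$. (ii) Suppose that $\Sigma=\{i,j\}$ where one of the embeddings $\xi\mapsto\xi^{(i)}$, $\xi\mapsto\xi^{(j)}$ is real and the other is complex. Then $\kappa(\Sigma)=\frac{2}{3}$.
   Context: For an algebraic number $\alpha$ of degree $r$ with conjugates $\alpha^{(1)},\dots,\alpha^{(r)}$, let $a_0$ be the positive integer such that $a_0\prod_{i=1}^r(X-\alpha^{(i)})$ has integer coefficients with greatest common divisor $1$; the Mahler measure is $M(\alpha)=a_0\prod_{i=1}^r\max(1,|\alpha^{(i)}|)$. For a number field $K$ of degree $r$ with embeddings $\xi\mapsto\xi^{(i)}$ ($i=1,\dots,r$) into $\mathbb{C}$, an embedding is real if it maps $K$ into $\mathbb{R}$ and complex otherwise; two embeddings $i,j$ are complex conjugate if $\xi^{(j)}=\overline{\xi^{(i)}}$ for all $\xi\in K$. For $\Sigma\subseteq\{1,\dots,r\}$ with $|\Sigma|\ge2$, $\kappa(\Sigma)$ is defined as the infimum of all real numbers $\kappa$ for which there exists a constant $C(K)>0$ such that $\prod_{\{i,j\}\subset\Sigma}|\alpha^{(i)}-\alpha^{(j)}|\ge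 C(K)\,M(\alpha)^{-\kappa}$ for every $\alpha$ with $\mathbb{Q}(\alpha)=K$, where the product is over all $2$-element subsets $\{i,j\}$ of $\Sigma$ and $\alpha^{(i)}$ denotes the image of $\alpha$ under the $i$-th embedding. *)

theory Defs
  imports
    Complex_Main
    "HOL-Library.Extended_Real"
    "HOL-Computational_Algebra.Computational_Algebra"
begin

text \<open>
  A number field is a type \<open>'k\<close> of class \<^class>\<open>field_char_0\<close> of finite dimension over the rationals.
\<close>

lemma vector_space_rat:
  "vector_space (\<lambda>(q::rat) (x::'k::field_char_0). of_rat q * x)"
  by unfold_locales (simp_all add: algebra_simps of_rat_add of_rat_mult)

text \<open>
  The value is \<open>0\<close> for an infinite extension, so degree \<open>r > 0\<close> includes finiteness.
\<close>

definition number_field_degree :: "'k::field_char_0 itself \<Rightarrow> nat" where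
  "number_field_degree _ =
     vector_space.dim (\<lambda>(q::rat) (x::'k). of_rat q * x) (UNIV :: 'k set)"

definition is_subfield :: "'k::field_char_0 set \<Rightarrow> bool" where
  "is_subfield F \<longleftrightarrow>
     0 \<in> F \<and> 1 \<in> F \<and>
     (\<forall>x\<in>F. \<forall>y\<in>F. x + y \<in> F) \<and> (\<forall>x\<in>F. - x \<in> F) \<and>
     (\<forall>x\<in>F. \<forall>y\<in>F. x * y \<in> F) \<and> (\<forall>x\<in>F. inverse x \<in> F)"

text \<open>
  In characteristic \<open>0\<close> every subfield contains the rationals, so the subfield generated by
  \<open>\<alpha>\<close> is \<open>\<rat>(\<alpha>)\<close>.
\<close>

definition rat_adjoin :: "'k::field_char_0 \<Rightarrow> 'k set" where
  "rat_adjoin \<alpha> = is_subfield hull {\<alpha>}"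

definition field_embedding :: "('k::field_char_0 \<Rightarrow> complex) \<Rightarrow> bool" where
  "field_embedding \<sigma> \<longleftrightarrow>
     \<sigma> 1 = 1 \<and> (\<forall>x y. \<sigma> (x + y) = \<sigma> x + \<sigma> y) \<and> (\<forall>x y. \<sigma> (x * y) = \<sigma> x * \<sigma> y)"

definition real_embedding :: "('k::field_char_0 \<Rightarrow> complex) \<Rightarrow> bool" where
  "real_embedding \<sigma> \<longleftrightarrow> field_embedding \<sigma> \<and> range \<sigma> \<subseteq> \<real>"

definition complex_embedding :: "('k::field_char_0 \<Rightarrow> complex) \<Rightarrow> bool" where
  "complex_embedding \<sigma> \<longleftrightarrow> field_embedding \<sigma> \<and> \<not> range \<sigma> \<subseteq> \<real>"

definition conjugate_embeddings ::
    "('k::field_char_0 \<Rightarrow> complex) \<Rightarrow> ('k \<Rightarrow> complex) \<Rightarrow> bool" where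
  "conjugate_embeddings \<sigma> \<tau> \<longleftrightarrow> (\<forall>\<xi>. \<tau> \<xi> = cnj (\<sigma> \<xi>))"

definition totally_real :: "'k::field_char_0 itself \<Rightarrow> bool" where
  "totally_real _ \<longleftrightarrow> (\<forall>\<sigma> :: 'k \<Rightarrow> complex. field_embedding \<sigma> \<longrightarrow> real_embedding \<sigma>)"

definition rat_min_poly :: "'k::field_char_0 \<Rightarrow> rat poly" where
  "rat_min_poly \<alpha> =
     (THE p. lead_coeff p = 1 \<and> irreducible p \<and> poly (map_poly of_rat p) \<alpha> = 0)"

text \<open>
  The minimal polynomial is separable, so an algebraic number of degree \<open>r\<close> has exactly \<open>r\<close>
  conjugates, and a product over this set is the product over \<open>\<alpha>\<^sup>(\<^sup>1\<^sup>), \<dots>, \<alpha>\<^sup>(\<^sup>r\<^sup>)\<close>.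
\<close>

definition alg_conjugates :: "'k::field_char_0 \<Rightarrow> complex set" where
  "alg_conjugates \<alpha> = {z. poly (map_poly of_rat (rat_min_poly \<alpha>)) z = 0}"

definition alg_leading_coeff :: "'k::field_char_0 \<Rightarrow> int" where
  "alg_leading_coeff \<alpha> =
     (THE a. a > 0 \<and>
        (\<exists>P :: int poly. content P = 1 \<and>
           map_poly of_int P = smult (of_int a) (\<Prod>z\<in>alg_conjugates \<alpha>. [:- z, 1:])))"

definition alg_mahler_measure :: "'k::field_char_0 \<Rightarrow> real" where
  "alg_mahler_measure \<alpha> =
     of_int (alg_leading_coeff \<alpha>) * (\<Prod>z\<in>alg_conjugates \<alpha>. max 1 (cmod z))"

text \<open>
  The two-element subsets \<open>{i, j}\<close> of \<open>\<Sigma>\<close> are enumerated by the pairs with \<open>i < j\<close>. The infimum is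
  taken in the extended reals, where it is \<open>\<infinity>\<close> for the empty set and \<open>-\<infinity>\<close> for a set that is
  not bounded below.
\<close>

definition root_separation_exponent ::
    "(nat \<Rightarrow> 'k::field_char_0 \<Rightarrow> complex) \<Rightarrow> nat set \<Rightarrow> ereal" where
  "root_separation_exponent emb \<Sigma> =
     Inf (ereal ` {\<kappa> :: real. \<exists>C :: real. C > 0 \<and>
       (\<forall>\<alpha> :: 'k. rat_adjoin \<alpha> = UNIV \<longrightarrow>
          (\<Prod>(i, j)\<in>{(i, j). i \<in> \<Sigma> \<and> j \<in> \<Sigma> \<and> i < j}. cmod (emb i \<alpha> - emb j \<alpha>))
            \<ge> C * alg_mahler_measure \<alpha> powr (- \<kappa>))})"

end

theory Submission
  imports Defs "HOL-Analysis.Kronecker_Approximation_Theorem"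
begin

text \<open>
  The discriminant \<open>a\<^sub>0\<^sup>4 \<Prod>(\<alpha>\<^sub>i - \<alpha>\<^sub>j)\<^sup>2\<close> of the primitive form of \<open>\<alpha>\<close> is a nonzero integer, so
  \<open>a\<^sub>0\<^sup>2 \<Prod>|\<alpha>\<^sub>i - \<alpha>\<^sub>j| \<ge> 1\<close>. With \<open>a\<^sub>0 \<le> M\<close> and \<open>|\<alpha>\<^sub>i - \<alpha>\<^sub>j| \<le> 2 max(1,|\<alpha>\<^sub>i|) max(1,|\<alpha>\<^sub>j|)\<close> this bounds the
  exponents by \<open>2\<close>. If \<open>\<alpha>\<^sub>1\<close> is real and \<open>\<alpha>\<^sub>2, \<alpha>\<^sub>3\<close> are complex conjugate, then
  \<open>|\<alpha>\<^sub>1 - \<alpha>\<^sub>3| = |\<alpha>\<^sub>1 - \<alpha>\<^sub>2|\<close> and \<open>|\<alpha>\<^sub>2 - \<alpha>\<^sub>3| \<le> 2|\<alpha>\<^sub>1 - \<alpha>\<^sub>2|\<close>, which improves the exponent to \<open>2/3\<close>.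

  For the converse, fix a generator \<open>\<alpha>\<close> and apply unimodular matrices to it. The numbers
  \<open>-1/(\<alpha> + n)\<close> have measure of order \<open>n\<^sup>3\<close> and all differences of order \<open>n\<^sup>-\<^sup>2\<close>, which settles
  \<open>\<Sigma> = {1, 2, 3}\<close> and the exponent \<open>2/3\<close>. If \<open>\<alpha>\<^sub>3\<close> is real, take \<open>\<beta> = (p\<alpha> + q)/(r\<alpha> + s)\<close> with
  \<open>-s/r\<close> a Dirichlet approximation of \<open>\<alpha>\<^sub>3\<close>: its measure is of order \<open>r\<close>, while
  \<open>\<beta>\<^sub>1 - \<beta>\<^sub>2\<close> is of order \<open>r\<^sup>-\<^sup>2\<close>.
\<close>

section \<open>Embeddings and subfields\<close>

lemma of_rat_in_subfield:
  assumes "is_subfield F"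
  shows "of_rat q \<in> F"
proof -
  have nat: "of_nat n \<in> F" for n
    by (induction n) (use assms in \<open>auto simp: is_subfield_def\<close>)
  have int: "of_int a \<in> F" for a
    by (cases a rule: int_cases2) (use assms nat in \<open>auto simp: is_subfield_def\<close>)
  obtain a b where ab: "quotient_of q = (a, b)"
    by (cases "quotient_of q")
  then have "q = of_int a / of_int b"
    by (rule quotient_of_div)
  then show ?thesis
    using assms int by (auto simp: is_subfield_def divide_inverse of_rat_mult of_rat_inverse)
qed

lemma rat_adjoin_subset:
  assumes "is_subfield F" "\<alpha> \<in> F"
  shows "rat_adjoin \<alpha> \<subseteq> F"
  unfolding rat_adjoin_def by (rule hull_minimal) (use assms in auto)

lemma rat_adjoin_eq_UNIV_I:
  assumes "\<And>F. is_subfield F \<Longrightarrow> \<alpha> \<in> F \<Longrightarrow> F = UNIV"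
  shows "rat_adjoin \<alpha> = UNIV"
  unfolding rat_adjoin_def hull_def using assms by auto

context
  fixes \<sigma> :: "'k::field_char_0 \<Rightarrow> complex"
  assumes \<sigma>: "field_embedding \<sigma>"
begin

lemma field_embedding_1: "\<sigma> 1 = 1"
  and field_embedding_add: "\<sigma> (x + y) = \<sigma> x + \<sigma> y"
  and field_embedding_mult: "\<sigma> (x * y) = \<sigma> x * \<sigma> y"
  using \<sigma> by (auto simp: field_embedding_def)

lemma field_embedding_0: "\<sigma> 0 = 0"
  using field_embedding_add[of 0 0] by simp

lemma field_embedding_minus: "\<sigma> (- x) = - \<sigma> x"
  using field_embedding_add[of x "- x"] by (simp add: field_embedding_0 add_eq_0_iff)

lemma field_embedding_eq_0_iff: "\<sigma> x = 0 \<longleftrightarrow> x = 0"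
proof
  assume "\<sigma> x = 0"
  show "x = 0"
  proof (rule ccontr)
    assume "x \<noteq> 0"
    then have "\<sigma> x * \<sigma> (inverse x) = 1"
      by (simp flip: field_embedding_mult add: field_embedding_1)
    with \<open>\<sigma> x = 0\<close> show False by simp
  qed
qed (simp add: field_embedding_0)

lemma field_embedding_inverse: "\<sigma> (inverse x) = inverse (\<sigma> x)"
proof (cases "x = 0")
  case False
  then have "\<sigma> x * \<sigma> (inverse x) = 1"
    by (simp flip: field_embedding_mult add: field_embedding_1)
  then show ?thesis
    by (metis inverse_unique)
qed (simp add: field_embedding_0)

lemma field_embedding_divide: "\<sigma> (x / y) = \<sigma> x / \<sigma> y"
  by (simp add: divide_inverse field_embedding_mult field_embedding_inverse)

lemma field_embedding_of_int: "\<sigma> (of_int a) = of_int a"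
proof -
  have nat: "\<sigma> (of_nat n) = of_nat n" for n
    by (induction n) (auto simp: field_embedding_0 field_embedding_1 field_embedding_add)
  show ?thesis
    by (cases a rule: int_cases2) (auto simp: field_embedding_minus nat)
qed

lemma field_embedding_of_rat: "\<sigma> (of_rat q) = of_rat q"
proof -
  obtain a b where ab: "quotient_of q = (a, b)"
    by (cases "quotient_of q")
  then have "q = of_int a / of_int b"
    by (rule quotient_of_div)
  then show ?thesis
    by (simp add: of_rat_divide field_embedding_divide field_embedding_of_int)
qed

lemma field_embedding_poly:
  "\<sigma> (poly (map_poly of_rat p) x) = poly (map_poly of_rat p) (\<sigma> x)"
  by (induction p)
    (simp_all add: map_poly_pCons field_embedding_0 field_embedding_add field_embedding_mult
      field_embedding_of_rat)

lemma field_embedding_cnj: "field_embedding (\<lambda>x. cnj (\<sigma> x))"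
  by (simp add: field_embedding_def field_embedding_1 field_embedding_add field_embedding_mult)

end

text \<open>If two embeddings agree at \<alpha>, they agree on all of Q(\<alpha>). Distinct
  embeddings therefore take distinct values at a generator.\<close>

lemma field_embeddings_agree_subfield:
  assumes "field_embedding \<sigma>" "field_embedding \<tau>"
  shows "is_subfield {x. \<sigma> x = \<tau> x}"
  using assms
  by (auto simp: is_subfield_def field_embedding_0 field_embedding_1 field_embedding_add
      field_embedding_mult field_embedding_minus field_embedding_inverse)

section \<open>Polynomials with rational and integer coefficients\<close>

lemma map_poly_of_rat_mult:
  "map_poly of_rat (p * q) = (map_poly of_rat p * map_poly of_rat q :: 'a::field_char_0 poly)"
  by (rule poly_eqI) (simp add: coeff_map_poly coeff_mult of_rat_sum of_rat_mult)

lemma map_poly_of_rat_add: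
  "map_poly of_rat (p + q) = (map_poly of_rat p + map_poly of_rat q :: 'a::field_char_0 poly)"
  by (rule poly_eqI) (simp add: coeff_map_poly of_rat_add)

lemma map_poly_of_int_mult:
  "map_poly of_int (p * q) = (map_poly of_int p * map_poly of_int q :: 'a::comm_ring_1 poly)"
  by (rule poly_eqI) (simp add: coeff_map_poly coeff_mult)

lemma map_poly_of_int_add:
  "map_poly of_int (p + q) = (map_poly of_int p + map_poly of_int q :: 'a::comm_ring_1 poly)"
  by (rule poly_eqI) (simp add: coeff_map_poly)

lemma map_poly_of_int_diff:
  "map_poly of_int (p - q) = (map_poly of_int p - map_poly of_int q :: 'a::comm_ring_1 poly)"
  by (rule poly_eqI) (simp add: coeff_map_poly)

lemma clear_denominators:
  fixes p :: "rat poly"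
  shows "\<exists>d P. d > 0 \<and> map_poly of_int P = smult (of_int d) p"
proof (induction p)
  case 0
  have "(1::int) > 0 \<and> map_poly of_int 0 = smult (of_int 1) (0 :: rat poly)"
    by simp
  then show ?case by blast
next
  case (pCons c q)
  obtain d P where d: "d > 0" and P: "map_poly of_int P = smult (of_int d) q"
    using pCons.IH by blast
  obtain a b where ab: "quotient_of c = (a, b)"
    by (cases "quotient_of c")
  have b: "b > 0" and c: "c = of_int a / of_int b"
    using quotient_of_denom_pos[OF ab] quotient_of_div[OF ab] by auto
  have "map_poly of_int (pCons (a * d) (smult b P)) = smult (of_int (b * d)) (pCons c q)"
    using b by (simp add: map_poly_pCons map_poly_smult P c mult.commute)
  with b d show ?case
    by (meson mult_pos_pos)
qed

text \<open>Clear the denominators of p and divide by the content g of the result. Comparing leading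
  coefficients gives d = g * a, so a is positive.\<close>

lemma monic_rat_poly_primitive_multiple:
  fixes p :: "rat poly"
  assumes "lead_coeff p = 1"
  obtains a P where "a > 0" "Polynomial.content P = 1" "map_poly of_int P = smult (of_int a) p"
proof -
  obtain d P where d: "d > 0" and P: "map_poly of_int P = smult (of_int d) p"
    using clear_denominators by blast
  define g a where "g = Polynomial.content P" and "a = lead_coeff (primitive_part P)"
  have P0: "P \<noteq> 0"
    using P d assms by auto
  have g: "g > 0"
    using P0 by (simp add: g_def less_le flip: content_eq_zero_iff)
       (metis normalize_content normalize_int_def abs_ge_zero)
  have Pg: "P = smult g (primitive_part P)"
    by (simp add: g_def)
  have "of_int (lead_coeff P) = lead_coeff (map_poly of_int P :: rat poly)"
    using P0 by (subst lead_coeff_map_poly_nz) auto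
  also have "\<dots> = of_int d"
    by (simp add: P assms)
  finally have "d = g * a"
    using arg_cong[OF Pg, of lead_coeff] g by (simp add: a_def flip: of_int_mult)
  with d g have a: "a > 0"
    by (simp add: zero_less_mult_iff)
  have "smult (of_int g) (map_poly of_int (primitive_part P)) = (map_poly of_int P :: rat poly)"
    by (subst (2) Pg) (simp add: map_poly_smult)
  also have "\<dots> = smult (of_int g) (smult (of_int a) p)"
    by (simp add: P \<open>d = g * a\<close>)
  finally have "map_poly of_int (primitive_part P) = smult (of_int a) p"
    using g by (metis of_int_eq_0_iff less_irrefl smult_eq_iff mult_1 divide_self_if smult_1_left)
  with a P0 show thesis
    by (intro that[of a "primitive_part P"]) auto
qed

section \<open>Cubic fields\<close>

text \<open>Four elements of a space of dimension 3 are dependent. The relation is indexed by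
  positions, so a repeated value f i = f j is treated apart, with coefficients 1 and -1.\<close>

lemma number_field_degree_3_dependent:
  fixes f :: "nat \<Rightarrow> 'k::field_char_0"
  assumes "number_field_degree TYPE('k) = 3"
  obtains c where "\<exists>i<4. c i \<noteq> 0" "(\<Sum>i<4. of_rat (c i) * f i) = 0"
proof (cases "inj_on f {..<4}")
  case True
  interpret Q: vector_space "\<lambda>(q::rat) (x::'k). of_rat q * x"
    by (rule vector_space_rat)
  have dim: "Q.dim (UNIV :: 'k set) = 3"
    using assms by (simp add: number_field_degree_def)
  obtain B :: "'k set" where B: "Q.independent B" "UNIV \<subseteq> Q.span B" "card B = 3"
    using Q.basis_exists[of "UNIV :: 'k set"] dim by metis
  have "finite B"
    using B(3) by (simp add: card_ge_0_finite)
  then have "\<not> Q.independent (f ` {..<4})"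
    using Q.independent_span_bound[of B "f ` {..<4}"] B True by (auto simp: card_image)
  then obtain u v where "v \<in> f ` {..<4}" "u v \<noteq> 0"
    and u: "(\<Sum>v\<in>f ` {..<4}. of_rat (u v) * v) = 0"
    by (auto simp: Q.dependent_finite)
  then have "\<exists>i<4. (u \<circ> f) i \<noteq> 0"
    by auto
  moreover have "(\<Sum>i<4. of_rat ((u \<circ> f) i) * f i) = 0"
    using u by (simp add: sum.reindex[OF True])
  ultimately show thesis
    by (rule that)
next
  case False
  then obtain i j where ij: "i < 4" "j < 4" "i \<noteq> j" "f i = f j"
    by (auto simp: inj_on_def)
  define c :: "nat \<Rightarrow> rat" where "c = (\<lambda>n. if n = i then 1 else if n = j then -1 else 0)"
  have "(\<Sum>n<4. of_rat (c n) * f n) = (\<Sum>n\<in>{i, j}. of_rat (c n) * f n)"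
    using ij by (intro sum.mono_neutral_right) (auto simp: c_def)
  also have "\<dots> = 0"
    using ij by (simp add: c_def)
  finally show thesis
    using ij by (intro that[of c]) (auto simp: c_def)
qed

text \<open>The three embeddings are given as an ordered triple, so that every statement about a
  pair can be made for \<sigma> and \<tau>. Other pairs are reached by interpreting the locale with
  the triple permuted.\<close>

locale cubic_field =
  fixes \<sigma> \<tau> \<rho> :: "'k::field_char_0 \<Rightarrow> complex"
  assumes degree_3: "number_field_degree TYPE('k) = 3"
    and embeddings: "{\<phi>. field_embedding \<phi>} = {\<sigma>, \<tau>, \<rho>}"
    and distinct: "\<sigma> \<noteq> \<tau>" "\<sigma> \<noteq> \<rho>" "\<tau> \<noteq> \<rho>"
begin

lemma emb_\<sigma>: "field_embedding \<sigma>" and emb_\<tau>: "field_embedding \<tau>" and emb_\<rho>: "field_embedding \<rho>"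
  using embeddings by blast+

text \<open>A criterion for Q(\<alpha>) = K that can be computed with; the equivalence is
  \<open>generator_iff\<close>.\<close>

definition distinct_conj :: "'k \<Rightarrow> bool" where
  "distinct_conj \<alpha> \<longleftrightarrow> \<sigma> \<alpha> \<noteq> \<tau> \<alpha> \<and> \<sigma> \<alpha> \<noteq> \<rho> \<alpha> \<and> \<tau> \<alpha> \<noteq> \<rho> \<alpha>"

definition conj_poly :: "'k \<Rightarrow> complex poly" where
  "conj_poly \<alpha> = [:- \<sigma> \<alpha>, 1:] * [:- \<tau> \<alpha>, 1:] * [:- \<rho> \<alpha>, 1:]"

lemma lead_coeff_conj_poly: "lead_coeff (conj_poly \<alpha>) = 1"
  by (simp add: conj_poly_def)

lemma conj_poly_nz: "conj_poly \<alpha> \<noteq> 0"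
  using lead_coeff_conj_poly[of \<alpha>] by auto

lemma poly_conj_poly: "poly (conj_poly \<alpha>) x = (x - \<sigma> \<alpha>) * (x - \<tau> \<alpha>) * (x - \<rho> \<alpha>)"
  by (simp add: conj_poly_def poly_mult del: mult_pCons_left mult_pCons_right)

text \<open>Embeddings send roots of a rational polynomial to roots, so a nonzero p would have three
  distinct complex roots and degree at least 3.\<close>

lemma annihilator_degree_le_2:
  assumes "distinct_conj \<alpha>" "poly (map_poly of_rat p) \<alpha> = 0" "degree p \<le> 2"
  shows "p = 0"
proof (rule ccontr)
  assume "p \<noteq> 0"
  define q :: "complex poly" where "q = map_poly of_rat p"
  have q: "q \<noteq> 0" "degree q \<le> 2"
    using \<open>p \<noteq> 0\<close> assms(3) by (auto simp: q_def map_poly_eq_0_iff degree_map_poly)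
  have root: "poly q (\<phi> \<alpha>) = 0" if "field_embedding \<phi>" for \<phi>
    unfolding q_def using field_embedding_poly[OF that, of p \<alpha>] assms(2) field_embedding_0[OF that]
    by simp
  have "{\<sigma> \<alpha>, \<tau> \<alpha>, \<rho> \<alpha>} \<subseteq> {x. poly q x = 0}"
    using root emb_\<sigma> emb_\<tau> emb_\<rho> by auto
  then have "card {\<sigma> \<alpha>, \<tau> \<alpha>, \<rho> \<alpha>} \<le> card {x. poly q x = 0}"
    using q poly_roots_finite by (intro card_mono) auto
  also have "\<dots> \<le> degree q"
    using q(1) by (rule card_poly_roots_bound)
  finally show False
    using q(2) assms(1) by (simp add: distinct_conj_def)
qed

lemma generator_iff: "rat_adjoin \<alpha> = UNIV \<longleftrightarrow> distinct_conj \<alpha>"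
proof
  assume gen: "rat_adjoin \<alpha> = UNIV"
  have "\<phi> \<alpha> \<noteq> \<psi> \<alpha>" if "field_embedding \<phi>" "field_embedding \<psi>" "\<phi> \<noteq> \<psi>" for \<phi> \<psi>
    using rat_adjoin_subset[OF field_embeddings_agree_subfield[OF that(1,2)], of \<alpha>] gen that(3)
    by (auto simp: fun_eq_iff)
  then show "distinct_conj \<alpha>"
    using emb_\<sigma> emb_\<tau> emb_\<rho> distinct by (simp add: distinct_conj_def)
next
  assume dist: "distinct_conj \<alpha>"
  show "rat_adjoin \<alpha> = UNIV"
  proof (rule rat_adjoin_eq_UNIV_I)
    fix F :: "'k set"
    assume F: "is_subfield F" "\<alpha> \<in> F"
    have "v \<in> F" for v
    proof -
      \<comment> \<open>The four elements are 1, \<alpha>, \<alpha>^2 and v. The first three are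
        independent, so v has a nonzero coefficient and is a rational polynomial in \<alpha>, hence
        lies in F.\<close>
      obtain c where c: "\<exists>i<4. c i \<noteq> 0"
        and sum: "(\<Sum>i<4. of_rat (c i) * (if i < 3 then \<alpha> ^ i else v)) = 0"
        by (rule number_field_degree_3_dependent[OF degree_3])
      define p where "p = [:c 0, c 1, c 2:]"
      have eq: "poly (map_poly of_rat p) \<alpha> + of_rat (c 3) * v = 0"
        using sum by (simp add: p_def map_poly_pCons eval_nat_numeral lessThan_Suc algebra_simps)
      have "c 3 \<noteq> 0"
      proof
        assume c3: "c 3 = 0"
        have "p = 0"
          by (rule annihilator_degree_le_2[OF dist]) (use eq c3 in \<open>auto simp: p_def\<close>)
        with c c3 show False
          by (auto simp: p_def eval_nat_numeral less_Suc_eq)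
      qed
      then have "v = - poly (map_poly of_rat p) \<alpha> * of_rat (inverse (c 3))"
        using eq by (simp add: of_rat_divide field_simps add_eq_0_iff)
      also have "poly (map_poly of_rat p) \<alpha> = of_rat (c 0) + \<alpha> * (of_rat (c 1) + \<alpha> * of_rat (c 2))"
        by (simp add: p_def map_poly_pCons)
      finally show ?thesis
        using F of_rat_in_subfield[OF F(1)] unfolding is_subfield_def by metis
    qed
    then show "F = UNIV" by auto
  qed
qed

lemma generator_exists: "\<exists>\<alpha>. distinct_conj \<alpha>"
proof -
  obtain x y z where xyz: "\<sigma> x \<noteq> \<tau> x" "\<sigma> y \<noteq> \<rho> y" "\<tau> z \<noteq> \<rho> z"
    using distinct by (meson ext)
  \<comment> \<open>For \<alpha> = x + n y + n^2 z the difference of two conjugates is a polynomial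
    in n. Each of the three is nonzero by the choice of x, y or z, so all but finitely many n
    separate all three embeddings.\<close>
  define P where "P = (\<lambda>\<phi> \<psi> :: 'k \<Rightarrow> complex. [:\<phi> x - \<psi> x, \<phi> y - \<psi> y, \<phi> z - \<psi> z:])"
  define Q where "Q = P \<sigma> \<tau> * P \<sigma> \<rho> * P \<tau> \<rho>"
  have "Q \<noteq> 0"
    using xyz by (simp add: Q_def P_def del: mult_pCons_left mult_pCons_right)
  then have "finite {t. poly Q t = 0}"
    by (rule poly_roots_finite)
  moreover have "infinite (range (of_nat :: nat \<Rightarrow> complex))"
    by (simp add: finite_image_iff inj_of_nat)
  ultimately obtain n :: nat where n: "poly Q (of_nat n) \<noteq> 0"
    by (metis (mono_tags, lifting) finite_subset image_subset_iff mem_Collect_eq)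
  define \<alpha> where "\<alpha> = x + of_int (int n) * y + of_int (int n) * of_int (int n) * z"
  have "poly (P \<phi> \<psi>) (of_nat n) = \<phi> \<alpha> - \<psi> \<alpha>" if "field_embedding \<phi>" "field_embedding \<psi>" for \<phi> \<psi>
    by (simp add: P_def \<alpha>_def field_embedding_add[OF that(1)] field_embedding_add[OF that(2)]
        field_embedding_mult[OF that(1)] field_embedding_mult[OF that(2)]
        field_embedding_of_int[OF that(1)] field_embedding_of_int[OF that(2)] algebra_simps
        del: of_int_of_nat_eq) (simp add: algebra_simps)
  then show ?thesis
    using n emb_\<sigma> emb_\<tau> emb_\<rho> by (auto simp: distinct_conj_def Q_def)
qed

section \<open>Minimal polynomial, conjugates and primitive integral multiple of a generator\<close>

lemma rat_min_poly_conj: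
  assumes "distinct_conj \<alpha>"
  shows "lead_coeff (rat_min_poly \<alpha>) = 1" "map_poly of_rat (rat_min_poly \<alpha>) = conj_poly \<alpha>"
proof -
  obtain c where c: "\<exists>i<4. c i \<noteq> 0" and sum: "(\<Sum>i<4. of_rat (c i) * \<alpha> ^ i) = 0"
    by (rule number_field_degree_3_dependent[OF degree_3])
  define r where "r = [:c 0, c 1, c 2, c 3:]"
  have r: "poly (map_poly of_rat r) \<alpha> = 0"
    using sum by (simp add: r_def map_poly_pCons eval_nat_numeral lessThan_Suc algebra_simps)
  have r0: "r \<noteq> 0"
    using c by (auto simp: r_def eval_nat_numeral less_Suc_eq)
  have c3: "c 3 \<noteq> 0"
  proof
    assume "c 3 = 0"
    then have "degree r \<le> 2"
      by (simp add: r_def)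
    with annihilator_degree_le_2[OF assms r] r0 show False by simp
  qed
  define p where "p = smult (inverse (c 3)) r"
  have p: "lead_coeff p = 1" "degree p = 3"
    using c3 by (auto simp: p_def r_def)
  have p\<alpha>: "poly (map_poly of_rat p) \<alpha> = 0"
    using r by (simp add: p_def map_poly_smult of_rat_mult)
  \<comment> \<open>One of two factors annihilates \<alpha> and so has degree at least 3, which
    leaves degree 0 for the other.\<close>
  have irr: "irreducible p"
  proof (rule irreducibleI)
    show "p \<noteq> 0" "\<not> p dvd 1"
      using p by (auto dest: dvd_imp_degree_le)
    fix a b assume ab: "p = a * b"
    then have ab0: "a \<noteq> 0" "b \<noteq> 0" "degree a + degree b = 3"
      using p \<open>p \<noteq> 0\<close> by (auto simp: degree_mult_eq)
    have "poly (map_poly of_rat a) \<alpha> = 0 \<or> poly (map_poly of_rat b) \<alpha> = 0"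
      using p\<alpha> by (simp add: ab map_poly_of_rat_mult)
    then have "\<not> degree a \<le> 2 \<or> \<not> degree b \<le> 2"
      using annihilator_degree_le_2[OF assms] ab0 by blast
    then have "degree a = 0 \<or> degree b = 0"
      using ab0 by linarith
    then show "a dvd 1 \<or> b dvd 1"
      using ab0 by (auto simp: is_unit_iff_degree)
  qed
  have "rat_min_poly \<alpha> = p"
    unfolding rat_min_poly_def
  proof (rule the_equality)
    fix q :: "rat poly"
    assume q: "lead_coeff q = 1 \<and> irreducible q \<and> poly (map_poly of_rat q) \<alpha> = 0"
    \<comment> \<open>Uniqueness by division: the remainder annihilates \<alpha> and has degree at
      most 2, so p divides q. Irreducibility makes the quotient constant, and monicity makes it
      1.\<close>
    have "q = q div p * p + q mod p"
      by simp
    then have "map_poly of_rat q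
        = (map_poly of_rat (q div p) * map_poly of_rat p + map_poly of_rat (q mod p) :: 'k poly)"
      by (metis map_poly_of_rat_add map_poly_of_rat_mult)
    then have "poly (map_poly of_rat (q mod p)) \<alpha> = 0"
      using q p\<alpha> by simp
    moreover have "degree (q mod p) \<le> 2"
      using degree_mod_less[of p q] p irr by (auto simp: irreducible_def)
    ultimately have "q mod p = 0"
      using annihilator_degree_le_2[OF assms] by blast
    then obtain s where s: "q = p * s"
      by auto
    with q irr have "s dvd 1"
      by (metis irreducible_def)
    then obtain k where k: "s = [:k:]"
      by (metis is_unit_polyE)
    have "k = 1"
      using q p(1) by (auto simp: s k split: if_splits)
    with s k show "q = p" by (simp add: one_pCons[symmetric])
  qed (use p irr p\<alpha> in auto)
  moreover have "map_poly of_rat p = conj_poly \<alpha>"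
  \<comment> \<open>Both polynomials are monic cubics, so their difference has degree at most 2, yet
    it vanishes at three distinct conjugates.\<close>
  proof (rule ccontr)
    define d where "d = map_poly of_rat p - conj_poly \<alpha>"
    assume "map_poly of_rat p \<noteq> conj_poly \<alpha>"
    then have d0: "d \<noteq> 0"
      by (simp add: d_def)
    have pr: "poly (map_poly of_rat p) (\<phi> \<alpha>) = 0" if "field_embedding \<phi>" for \<phi>
      using field_embedding_poly[OF that, of p \<alpha>] p\<alpha> field_embedding_0[OF that] by simp
    have "{\<sigma> \<alpha>, \<tau> \<alpha>, \<rho> \<alpha>} \<subseteq> {x. poly d x = 0}"
      using pr emb_\<sigma> emb_\<tau> emb_\<rho> by (auto simp: d_def poly_conj_poly)
    then have "card {\<sigma> \<alpha>, \<tau> \<alpha>, \<rho> \<alpha>} \<le> card {x. poly d x = 0}"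
      using d0 poly_roots_finite by (intro card_mono) auto
    also have "\<dots> \<le> degree d"
      using d0 by (rule card_poly_roots_bound)
    also have "degree d \<le> 2"
      using c3 by (simp add: d_def p_def r_def conj_poly_def map_poly_pCons)
    finally show False
      using assms by (simp add: distinct_conj_def)
  qed
  ultimately show "lead_coeff (rat_min_poly \<alpha>) = 1" "map_poly of_rat (rat_min_poly \<alpha>) = conj_poly \<alpha>"
    using p by auto
qed

lemma alg_conjugates_eq:
  assumes "distinct_conj \<alpha>"
  shows "alg_conjugates \<alpha> = {\<sigma> \<alpha>, \<tau> \<alpha>, \<rho> \<alpha>}"
  unfolding alg_conjugates_def rat_min_poly_conj(2)[OF assms]
  by (auto simp: poly_conj_poly)

lemma prod_alg_conjugates:
  assumes "distinct_conj \<alpha>"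
  shows "(\<Prod>z\<in>alg_conjugates \<alpha>. f z) = f (\<sigma> \<alpha>) * f (\<tau> \<alpha>) * f (\<rho> \<alpha>)"
  using assms by (simp add: alg_conjugates_eq distinct_conj_def mult.assoc)

text \<open>Here b is the integer leading coefficient of Q, and b P = a Q. Taking contents, with P
  primitive, gives |b| = a * content Q. The lemma serves twice: for the uniqueness of a, and to
  bound the leading coefficient after a unimodular substitution.\<close>

lemma primitive_multiple_le:
  fixes a :: int
  assumes "a > 0" "Polynomial.content P = 1" "map_poly of_int P = smult (of_int a) (conj_poly \<alpha>)"
    and "b \<noteq> 0" "map_poly of_int Q = smult b (conj_poly \<alpha>)"
  shows "real_of_int a \<le> cmod b"
proof -
  have Q0: "Q \<noteq> 0"
    using assms(4,5) conj_poly_nz by auto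
  define l where "l = lead_coeff Q"
  have "of_int l = lead_coeff (map_poly of_int Q :: complex poly)"
    using Q0 by (subst lead_coeff_map_poly_nz) (auto simp: l_def)
  then have b: "b = of_int l"
    by (simp add: assms(5) lead_coeff_conj_poly)
  have "map_poly of_int (smult l P) = (map_poly of_int (smult a Q) :: complex poly)"
    by (simp add: map_poly_smult assms b mult.commute)
  then have "smult l P = smult a Q"
    by (simp add: poly_eq_iff coeff_map_poly flip: of_int_mult)
  then have "Polynomial.content (smult l P) = Polynomial.content (smult a Q)"
    by (rule arg_cong)
  then have "\<bar>l\<bar> = a * Polynomial.content Q"
    using assms(1,2) by simp
  moreover have "Polynomial.content Q \<ge> 1"
    using Q0 content_eq_zero_iff[of Q]
    by (metis abs_ge_zero int_one_le_iff_zero_less less_le normalize_content normalize_int_def)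
  ultimately have "a \<le> \<bar>l\<bar>"
    using assms(1) by simp
  then show ?thesis
    by (simp add: b flip: of_int_abs)
qed

lemma alg_leading_coeff_primitive:
  assumes "distinct_conj \<alpha>"
  obtains P where "alg_leading_coeff \<alpha> > 0" "Polynomial.content P = 1"
    "map_poly of_int P = smult (of_int (alg_leading_coeff \<alpha>)) (conj_poly \<alpha>)"
proof -
  obtain a P where aP: "a > 0" "Polynomial.content P = 1"
    "map_poly of_int P = smult (of_int a) (rat_min_poly \<alpha>)"
    using monic_rat_poly_primitive_multiple rat_min_poly_conj(1)[OF assms] by metis
  have "map_poly of_rat (map_poly of_int P) = (smult (of_int a) (conj_poly \<alpha>))"
    by (simp add: aP map_poly_smult of_rat_mult rat_min_poly_conj(2)[OF assms])
  moreover have "map_poly of_rat (map_poly of_int P) = (map_poly of_int P :: complex poly)"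
    by (simp add: poly_eq_iff coeff_map_poly)
  ultimately have P: "map_poly of_int P = smult (of_int a) (conj_poly \<alpha>)"
    by simp
  have "alg_leading_coeff \<alpha> = a"
    unfolding alg_leading_coeff_def prod_alg_conjugates[OF assms] conj_poly_def[symmetric]
  proof (rule the_equality)
    show "0 < a \<and> (\<exists>P. Polynomial.content P = 1 \<and> map_poly of_int P = smult (of_int a) (conj_poly \<alpha>))"
      using aP P by blast
    fix b :: int
    assume b: "0 < b \<and> (\<exists>P. Polynomial.content P = 1 \<and> map_poly of_int P = smult (of_int b) (conj_poly \<alpha>))"
    then obtain Q where Q: "Polynomial.content Q = 1" "map_poly of_int Q = smult (of_int b) (conj_poly \<alpha>)"
      by blast
    show "b = a"
      using primitive_multiple_le[OF aP(1,2) P _ Q(2)] primitive_multiple_le[OF _ Q _ P] b aP(1)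
      by simp
  qed
  with aP P show thesis
    by (intro that) auto
qed

end

section \<open>Root separation in cubic fields\<close>

context cubic_field
begin

section \<open>Mahler measure and discriminant\<close>

lemma mahler_measure_eq:
  assumes "distinct_conj \<alpha>"
  shows "alg_mahler_measure \<alpha> = of_int (alg_leading_coeff \<alpha>) *
    (max 1 (cmod (\<sigma> \<alpha>)) * max 1 (cmod (\<tau> \<alpha>)) * max 1 (cmod (\<rho> \<alpha>)))"
  by (simp add: alg_mahler_measure_def prod_alg_conjugates[OF assms])

lemma alg_leading_coeff_ge_1:
  assumes "distinct_conj \<alpha>"
  shows "1 \<le> alg_leading_coeff \<alpha>"
  using alg_leading_coeff_primitive[OF assms] by (metis int_one_le_iff_zero_less)

lemma alg_leading_coeff_le_mahler:
  assumes "distinct_conj \<alpha>"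
  shows "alg_leading_coeff \<alpha> \<le> alg_mahler_measure \<alpha>"
proof -
  have "1 * 1 * 1 \<le> max 1 (cmod (\<sigma> \<alpha>)) * max 1 (cmod (\<tau> \<alpha>)) * max 1 (cmod (\<rho> \<alpha>))"
    by (intro mult_mono) auto
  then have "of_int (alg_leading_coeff \<alpha>) * 1 \<le> alg_mahler_measure \<alpha>"
    unfolding mahler_measure_eq[OF assms]
    using alg_leading_coeff_ge_1[OF assms] by (intro mult_left_mono) auto
  then show ?thesis by simp
qed

lemma mahler_measure_ge_1:
  assumes "distinct_conj \<alpha>"
  shows "1 \<le> alg_mahler_measure \<alpha>"
  using alg_leading_coeff_le_mahler[OF assms] alg_leading_coeff_ge_1[OF assms] by linarith

text \<open>Vieta's formulas, which turn symmetric expressions in the conjugates into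
  integers.\<close>

lemma int_poly_conj_coeffs:
  assumes "map_poly of_int P = smult a (conj_poly \<alpha>)"
  shows "of_int (coeff P 3) = a"
    and "of_int (coeff P 2) = - a * (\<sigma> \<alpha> + \<tau> \<alpha> + \<rho> \<alpha>)"
    and "of_int (coeff P 1) = a * (\<sigma> \<alpha> * \<tau> \<alpha> + \<sigma> \<alpha> * \<rho> \<alpha> + \<tau> \<alpha> * \<rho> \<alpha>)"
    and "of_int (coeff P 0) = - a * (\<sigma> \<alpha> * \<tau> \<alpha> * \<rho> \<alpha>)"
proof -
  have c: "of_int (coeff P n) = a * coeff (conj_poly \<alpha>) n" for n
    using arg_cong[OF assms, of "\<lambda>p. coeff p n"] by (simp add: coeff_map_poly)
  show "of_int (coeff P 3) = a"
    and "of_int (coeff P 2) = - a * (\<sigma> \<alpha> + \<tau> \<alpha> + \<rho> \<alpha>)"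
    and "of_int (coeff P 1) = a * (\<sigma> \<alpha> * \<tau> \<alpha> + \<sigma> \<alpha> * \<rho> \<alpha> + \<tau> \<alpha> * \<rho> \<alpha>)"
    and "of_int (coeff P 0) = - a * (\<sigma> \<alpha> * \<tau> \<alpha> * \<rho> \<alpha>)"
    by (simp_all add: c conj_poly_def eval_nat_numeral algebra_simps)
qed

text \<open>The discriminant is an integer, nonzero because the conjugates are distinct. The
  right-hand side is the square root of its absolute value.\<close>

lemma discriminant_ge_1:
  assumes "distinct_conj \<alpha>"
  shows "1 \<le> (real_of_int (alg_leading_coeff \<alpha>))\<^sup>2 *
    (cmod (\<sigma> \<alpha> - \<tau> \<alpha>) * cmod (\<sigma> \<alpha> - \<rho> \<alpha>) * cmod (\<tau> \<alpha> - \<rho> \<alpha>))"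
proof -
  define a where "a = alg_leading_coeff \<alpha>"
  define x y z where "x = \<sigma> \<alpha>" and "y = \<tau> \<alpha>" and "z = \<rho> \<alpha>"
  obtain P where a: "a > 0" and P: "map_poly of_int P = smult (of_int a) (conj_poly \<alpha>)"
    using alg_leading_coeff_primitive[OF assms] unfolding a_def by metis
  define c3 c2 c1 c0 where "c3 = coeff P 3" and "c2 = coeff P 2"
    and "c1 = coeff P 1" and "c0 = coeff P 0"
  note c = int_poly_conj_coeffs[OF P, folded x_def y_def z_def c3_def c2_def c1_def c0_def]
  \<comment> \<open>The discriminant of c3 X^3 + c2 X^2 + c1 X + c0, written in the coefficients so
    that it is visibly an integer.\<close>
  define \<Delta> where
    "\<Delta> = c2\<^sup>2 * c1\<^sup>2 - 4 * c3 * c1 ^ 3 - 4 * c2 ^ 3 * c0 - 27 * c3\<^sup>2 * c0\<^sup>2 + 18 * c3 * c2 * c1 * c0"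
  have \<Delta>: "of_int \<Delta> = ((of_int a)\<^sup>2 * ((x - y) * (x - z) * (y - z)))\<^sup>2"
    unfolding \<Delta>_def of_int_add of_int_diff of_int_mult of_int_power of_int_numeral c
    by algebra
  have "((of_int a)\<^sup>2 * ((x - y) * (x - z) * (y - z)))\<^sup>2 \<noteq> 0"
    using a assms by (auto simp: distinct_conj_def x_def y_def z_def)
  then have "\<Delta> \<noteq> 0"
    by (metis \<Delta> of_int_0)
  then have "1 \<le> \<bar>real_of_int \<Delta>\<bar>"
    by linarith
  also have "\<dots> = cmod (of_int \<Delta>)"
    by simp
  also have "\<dots> = ((real_of_int a)\<^sup>2 * (cmod (x - y) * cmod (x - z) * cmod (y - z)))\<^sup>2"
    unfolding \<Delta> using a by (simp add: norm_mult norm_power)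
  finally have "1\<^sup>2 \<le> ((real_of_int a)\<^sup>2 * (cmod (x - y) * cmod (x - z) * cmod (y - z)))\<^sup>2"
    by simp
  then show ?thesis
    unfolding a_def x_def y_def z_def by (rule power2_le_imp_le) simp
qed

section \<open>Lower bounds for the differences of conjugates\<close>

lemma separation_all:
  assumes "distinct_conj \<alpha>"
  shows "alg_mahler_measure \<alpha> powr (-2) \<le>
    cmod (\<sigma> \<alpha> - \<tau> \<alpha>) * cmod (\<sigma> \<alpha> - \<rho> \<alpha>) * cmod (\<tau> \<alpha> - \<rho> \<alpha>)" (is "_ \<le> ?D")
proof -
  have "1 \<le> (real_of_int (alg_leading_coeff \<alpha>))\<^sup>2 * ?D"
    by (rule discriminant_ge_1[OF assms])
  also have "\<dots> \<le> (alg_mahler_measure \<alpha>)\<^sup>2 * ?D"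
    using alg_leading_coeff_le_mahler[OF assms] alg_leading_coeff_ge_1[OF assms]
    by (intro mult_right_mono power_mono) auto
  finally show ?thesis
    using mahler_measure_ge_1[OF assms] by (simp add: powr_minus powr_realpow field_simps)
qed

text \<open>In the discriminant bound the two differences that involve \<rho> are at most 2sr and
  2tr, where s, t, r are the factors max(1, |.|) of the measure M = a s t r. What remains is 1 <= 4
  (ar)^2 (st) d, and st <= (st)^2 completes M^2.\<close>

lemma separation_pair:
  assumes "distinct_conj \<alpha>"
  shows "1 / 4 * alg_mahler_measure \<alpha> powr (-2) \<le> cmod (\<sigma> \<alpha> - \<tau> \<alpha>)" (is "_ \<le> ?d")
proof -
  define a where "a = real_of_int (alg_leading_coeff \<alpha>)"
  define m where "m = (\<lambda>z. max 1 (cmod z))"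
  have m: "1 \<le> m z" for z
    by (simp add: m_def)
  have a: "a \<ge> 1"
    using alg_leading_coeff_ge_1[OF assms] by (simp add: a_def)
  have diff: "cmod (u - v) \<le> 2 * (m u * m v)" for u v
  proof -
    have "m u * 1 \<le> m u * m v" "1 * m v \<le> m u * m v"
      using m[of u] m[of v] by (intro mult_mono; simp)+
    moreover have "cmod u \<le> m u" "cmod v \<le> m v"
      by (simp_all add: m_def)
    ultimately show ?thesis
      using norm_triangle_ineq4[of u v] by linarith
  qed
  define s t r where "s = m (\<sigma> \<alpha>)" and "t = m (\<tau> \<alpha>)" and "r = m (\<rho> \<alpha>)"
  have str: "1 \<le> s" "1 \<le> t" "1 \<le> r"
    by (simp_all add: s_def t_def r_def m)
  have M: "alg_mahler_measure \<alpha> = a * (s * t * r)"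
    by (simp add: mahler_measure_eq[OF assms] a_def m_def s_def t_def r_def)
  have "1 \<le> a\<^sup>2 * (?d * cmod (\<sigma> \<alpha> - \<rho> \<alpha>) * cmod (\<tau> \<alpha> - \<rho> \<alpha>))"
    unfolding a_def by (rule discriminant_ge_1[OF assms])
  also have "\<dots> \<le> a\<^sup>2 * (?d * (2 * (s * r)) * (2 * (t * r)))"
    using diff[of "\<sigma> \<alpha>" "\<rho> \<alpha>"] diff[of "\<tau> \<alpha>" "\<rho> \<alpha>"] str
    unfolding s_def t_def r_def by (intro mult_left_mono mult_mono) auto
  also have "\<dots> = (4 * (a * r)\<^sup>2 * ?d) * (s * t)"
    by (simp add: power2_eq_square algebra_simps)
  also have "\<dots> \<le> (4 * (a * r)\<^sup>2 * ?d) * (s * t)\<^sup>2"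
    using str mult_mono[of 1 s 1 t]
    by (intro mult_left_mono self_le_power) auto
  also have "\<dots> = 4 * (alg_mahler_measure \<alpha>)\<^sup>2 * ?d"
    by (simp add: M power2_eq_square algebra_simps)
  finally show ?thesis
    using mahler_measure_ge_1[OF assms] by (simp add: powr_minus powr_realpow field_simps)
qed

text \<open>Conjugation fixes \<sigma>(\<alpha>) and exchanges the other two conjugates, so all
  three differences are at most twice d and \<open>separation_all\<close> becomes M^(-2) <= 2
  d^3.\<close>

lemma separation_real_complex:
  assumes "distinct_conj \<alpha>" and "\<sigma> \<alpha> \<in> \<real>" and "\<rho> \<alpha> = cnj (\<tau> \<alpha>)"
  shows "1 / 2 * alg_mahler_measure \<alpha> powr (-(2/3)) \<le> cmod (\<sigma> \<alpha> - \<tau> \<alpha>)" (is "_ \<le> ?d")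
proof -
  let ?M = "alg_mahler_measure \<alpha>"
  have M: "1 \<le> ?M"
    by (rule mahler_measure_ge_1[OF assms(1)])
  have "\<sigma> \<alpha> - \<rho> \<alpha> = cnj (\<sigma> \<alpha> - \<tau> \<alpha>)"
    using assms by (simp add: Reals_cnj_iff)
  then have d1: "cmod (\<sigma> \<alpha> - \<rho> \<alpha>) = ?d"
    by (metis complex_mod_cnj)
  have d2: "cmod (\<tau> \<alpha> - \<rho> \<alpha>) \<le> 2 * ?d"
    using norm_triangle_ineq4[of "\<sigma> \<alpha> - \<rho> \<alpha>" "\<sigma> \<alpha> - \<tau> \<alpha>"] d1 by simp
  have "?M powr (-2) \<le> ?d * cmod (\<sigma> \<alpha> - \<rho> \<alpha>) * cmod (\<tau> \<alpha> - \<rho> \<alpha>)"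
    by (rule separation_all[OF assms(1)])
  also have "\<dots> \<le> ?d * ?d * (2 * ?d)"
    unfolding d1 using d2 by (intro mult_left_mono) auto
  finally have *: "?M powr (-2) \<le> 2 * ?d ^ 3"
    by (simp add: power3_eq_cube)
  \<comment> \<open>A cube root is avoided by comparing cubes; the constant 1/2 suffices because its
    cube 1/8 is at most 1/2.\<close>
  have "(1 / 2 * ?M powr (-(2/3))) ^ 3 = 1 / 8 * ?M powr (-2)"
    using M by (simp add: power_mult_distrib power_divide powr_powr flip: powr_realpow)
  also have "\<dots> \<le> 1 / 2 * ?M powr (-2)"
    by simp
  also have "\<dots> \<le> ?d ^ 3"
    using * by simp
  finally show ?thesis
    by (rule power_le_imp_le_base[where n = 2, simplified]) simp
qed

section \<open>Unimodular substitutions\<close>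

lemma linear_form_nz:
  fixes r s :: int
  assumes "distinct_conj \<alpha>" "field_embedding \<phi>" "r \<noteq> 0 \<or> s \<noteq> 0"
  shows "of_int r * \<phi> \<alpha> + of_int s \<noteq> 0"
proof
  have lin: "\<psi> (of_int r * \<alpha> + of_int s) = of_int r * \<psi> \<alpha> + of_int s" if "field_embedding \<psi>" for \<psi>
    by (simp add: field_embedding_add[OF that] field_embedding_mult[OF that]
        field_embedding_of_int[OF that])
  assume "of_int r * \<phi> \<alpha> + of_int s = 0"
  then have 0: "of_int r * \<alpha> + of_int s = 0"
    using lin[OF assms(2)] field_embedding_eq_0_iff[OF assms(2)] by simp
  \<comment> \<open>A relation r\<alpha> + s = 0 holds under every embedding. Subtracting two of
    them eliminates s and leaves r times a nonzero difference.\<close>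
  then have "of_int r * \<sigma> \<alpha> + of_int s = 0" "of_int r * \<tau> \<alpha> + of_int s = 0"
    using lin[OF emb_\<sigma>] lin[OF emb_\<tau>] field_embedding_0[OF emb_\<sigma>] field_embedding_0[OF emb_\<tau>]
    by simp_all
  then have "of_int r * (\<sigma> \<alpha> - \<tau> \<alpha>) = 0"
    by (simp add: algebra_simps add_eq_0_iff)
  then have "r = 0"
    using assms(1) by (simp add: distinct_conj_def)
  with 0 assms(3) show False by simp
qed

definition moebius :: "int \<Rightarrow> int \<Rightarrow> int \<Rightarrow> int \<Rightarrow> 'k \<Rightarrow> 'k" where
  "moebius p q r s \<alpha> = (of_int p * \<alpha> + of_int q) / (of_int r * \<alpha> + of_int s)"

lemma embedding_moebius:
  assumes "field_embedding \<phi>"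
  shows "\<phi> (moebius p q r s \<alpha>) = (of_int p * \<phi> \<alpha> + of_int q) / (of_int r * \<phi> \<alpha> + of_int s)"
  by (simp add: moebius_def field_embedding_add[OF assms] field_embedding_mult[OF assms]
        field_embedding_of_int[OF assms] field_embedding_divide[OF assms])

text \<open>Over the common denominator, the numerator is the determinant times \<phi>(\<alpha>) -
  \<psi>(\<alpha>). Large values of r\<alpha> + s therefore bring the conjugates together.\<close>

lemma moebius_diff:
  assumes "distinct_conj \<alpha>" "p * s - q * r = 1" "field_embedding \<phi>" "field_embedding \<psi>"
  shows "\<phi> (moebius p q r s \<alpha>) - \<psi> (moebius p q r s \<alpha>) =
    (\<phi> \<alpha> - \<psi> \<alpha>) / ((of_int r * \<phi> \<alpha> + of_int s) * (of_int r * \<psi> \<alpha> + of_int s))"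
proof -
  have "r \<noteq> 0 \<or> s \<noteq> 0"
    using assms(2) by auto
  then have nz: "of_int r * \<phi> \<alpha> + of_int s \<noteq> 0" "of_int r * \<psi> \<alpha> + of_int s \<noteq> 0"
    using linear_form_nz[OF assms(1)] assms(3,4) by auto
  have det: "of_int p * of_int s - of_int q * of_int r = (1 :: complex)"
    using assms(2) by (metis of_int_1 of_int_diff of_int_mult)
  have "(of_int p * \<phi> \<alpha> + of_int q) * (of_int r * \<psi> \<alpha> + of_int s)
      - (of_int p * \<psi> \<alpha> + of_int q) * (of_int r * \<phi> \<alpha> + of_int s)
      = (of_int p * of_int s - of_int q * of_int r) * (\<phi> \<alpha> - \<psi> \<alpha>)"
    by (simp add: algebra_simps)
  with nz det show ?thesis
    by (simp add: embedding_moebius assms diff_frac_eq)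
qed

text \<open>By \<open>moebius_diff\<close> the new differences are nonzero multiples of the old
  ones, so the image of a generator is again a generator.\<close>

lemma distinct_conj_moebius:
  assumes "distinct_conj \<alpha>" "p * s - q * r = 1"
  shows "distinct_conj (moebius p q r s \<alpha>)"
proof -
  have "r \<noteq> 0 \<or> s \<noteq> 0"
    using assms(2) by auto
  then have "\<phi> (moebius p q r s \<alpha>) \<noteq> \<psi> (moebius p q r s \<alpha>)"
    if "field_embedding \<phi>" "field_embedding \<psi>" "\<phi> \<alpha> \<noteq> \<psi> \<alpha>" for \<phi> \<psi>
    using moebius_diff[OF assms that(1,2)] linear_form_nz[OF assms(1)] that
    by (metis divide_eq_0_iff mult_eq_0_iff right_minus_eq)
  then show ?thesis
    using assms(1) emb_\<sigma> emb_\<tau> emb_\<rho> by (simp add: distinct_conj_def)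
qed

text \<open>
  Substituting a unimodular matrix into the binary cubic form of \<open>\<alpha>\<close> yields an integral form with
  root \<open>(p\<alpha> + q)/(r\<alpha> + s)\<close>, whose leading coefficient is a multiple of the primitive one.
\<close>

lemma mahler_moebius_le:
  assumes "distinct_conj \<alpha>" "p * s - q * r = 1"
  defines "h \<equiv> \<lambda>\<phi>. max (cmod (of_int r * \<phi> \<alpha> + of_int s)) (cmod (of_int p * \<phi> \<alpha> + of_int q))"
  shows "alg_mahler_measure (moebius p q r s \<alpha>)
    \<le> of_int (alg_leading_coeff \<alpha>) * (h \<sigma> * h \<tau> * h \<rho>)"
proof -
  define \<beta> where "\<beta> = moebius p q r s \<alpha>"
  define a where "a = alg_leading_coeff \<alpha>"
  define l where "l = (\<lambda>\<phi>. of_int r * \<phi> \<alpha> + (of_int s :: complex))"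
  define b where "b = of_int a * (l \<sigma> * l \<tau> * l \<rho>)"
  have dist: "distinct_conj \<beta>"
    unfolding \<beta>_def by (rule distinct_conj_moebius[OF assms(1,2)])
  have "r \<noteq> 0 \<or> s \<noteq> 0"
    using assms(2) by auto
  then have lnz: "l \<phi> \<noteq> 0" if "field_embedding \<phi>" for \<phi>
    unfolding l_def using linear_form_nz[OF assms(1) that] by blast
  have l\<beta>: "l \<phi> * \<phi> \<beta> = of_int p * \<phi> \<alpha> + of_int q" if "field_embedding \<phi>" for \<phi>
    using lnz[OF that] by (simp add: \<beta>_def embedding_moebius[OF that] l_def)
  obtain P where a: "a > 0" and P: "map_poly of_int P = smult (of_int a) (conj_poly \<alpha>)"
    using alg_leading_coeff_primitive[OF assms(1)] unfolding a_def by metis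
  \<comment> \<open>Since \<alpha> = (s\<beta> - q)/(p - r\<beta>), the number \<beta> is a root of
    F(B, -A), where F is the binary cubic form of \<alpha>, A = rX - p and B = sX - q; this is
    Q.\<close>
  define A B where "A = [:- p, r:]" and "B = [:- q, s:]"
  define Q where "Q = smult (coeff P 3) (B * B * B) - smult (coeff P 2) (B * B * A)
    + smult (coeff P 1) (B * A * A) - smult (coeff P 0) (A * A * A)"
  have Q: "map_poly of_int Q = smult b (conj_poly \<beta>)"
  proof (subst poly_eq_poly_eq_iff[symmetric], rule ext)
    fix x :: complex
    define u v where "u = poly (map_poly of_int A) x" and "v = poly (map_poly of_int B) x"
    have uv: "u = of_int r * x - of_int p" "v = of_int s * x - of_int q"
      by (simp_all add: u_def v_def A_def B_def map_poly_pCons algebra_simps)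
    have *: "l \<phi> * (x - \<phi> \<beta>) = v + u * \<phi> \<alpha>" if "field_embedding \<phi>" for \<phi>
      unfolding right_diff_distrib l\<beta>[OF that] by (simp add: uv l_def algebra_simps)
    have "poly (map_poly of_int Q) x = of_int (coeff P 3) * (v * v * v)
        - of_int (coeff P 2) * (v * v * u) + of_int (coeff P 1) * (v * u * u)
        - of_int (coeff P 0) * (u * u * u)"
      by (simp add: Q_def map_poly_of_int_mult map_poly_of_int_add map_poly_of_int_diff
          map_poly_smult u_def v_def)
    also have "\<dots> = of_int a * ((v + u * \<sigma> \<alpha>) * (v + u * \<tau> \<alpha>) * (v + u * \<rho> \<alpha>))"
      unfolding int_poly_conj_coeffs[OF P] by algebra
    also have "\<dots> = poly (smult b (conj_poly \<beta>)) x"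
      unfolding *[OF emb_\<sigma>, symmetric] *[OF emb_\<tau>, symmetric] *[OF emb_\<rho>, symmetric]
      by (simp add: poly_conj_poly b_def)
    finally show "poly (map_poly of_int Q) x = poly (smult b (conj_poly \<beta>)) x" .
  qed
  have b0: "b \<noteq> 0"
    using a lnz emb_\<sigma> emb_\<tau> emb_\<rho> by (simp add: b_def)
  obtain R where R: "alg_leading_coeff \<beta> > 0" "Polynomial.content R = 1"
    "map_poly of_int R = smult (of_int (alg_leading_coeff \<beta>)) (conj_poly \<beta>)"
    using alg_leading_coeff_primitive[OF dist] .
  have le: "real_of_int (alg_leading_coeff \<beta>) \<le> cmod b"
    by (rule primitive_multiple_le[OF R b0 Q])
  \<comment> \<open>The denominator of \<phi>(\<beta>), which enters through the leading coefficient
    b, turns max(1, |\<phi>(\<beta>)|) into the larger of denominator and numerator.\<close>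
  have h: "cmod (l \<phi>) * max 1 (cmod (\<phi> \<beta>)) = h \<phi>" if "field_embedding \<phi>" for \<phi>
    unfolding h_def l\<beta>[OF that, symmetric] by (simp add: max_mult_distrib_left norm_mult l_def)
  have "alg_mahler_measure \<beta> \<le> cmod b *
      (max 1 (cmod (\<sigma> \<beta>)) * max 1 (cmod (\<tau> \<beta>)) * max 1 (cmod (\<rho> \<beta>)))"
    unfolding mahler_measure_eq[OF dist] using le by (intro mult_right_mono) auto
  also have "\<dots> = of_int a * (h \<sigma> * h \<tau> * h \<rho>)"
    using a unfolding h[OF emb_\<sigma>, symmetric] h[OF emb_\<tau>, symmetric] h[OF emb_\<rho>, symmetric]
    by (simp add: b_def norm_mult algebra_simps)
  finally show ?thesis
    by (simp add: \<beta>_def a_def)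
qed

end

section \<open>Exponents\<close>

text \<open>Along the family, a lower bound with exponent k in [0, e) would give C (A t)^(-k) <= B
  t^(-e) for arbitrarily large t, so t^(e - k) would stay bounded.\<close>

lemma exponent_ge:
  fixes M d :: "'a \<Rightarrow> real"
  assumes "C > 0" and bound: "\<And>\<alpha>. G \<alpha> \<Longrightarrow> C * M \<alpha> powr (- \<kappa>) \<le> d \<alpha>"
    and M1: "\<And>\<alpha>. G \<alpha> \<Longrightarrow> 1 \<le> M \<alpha>"
    and "A > 0" "B > 0"
    and family: "\<And>N. \<exists>\<alpha> t. G \<alpha> \<and> N \<le> t \<and> M \<alpha> \<le> A * t \<and> d \<alpha> \<le> B * t powr (- e)"
    and "e > 0"
  shows "e \<le> \<kappa>"
proof (rule ccontr)
  assume "\<not> e \<le> \<kappa>"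
  \<comment> \<open>A negative \<kappa> is replaced by 0, which only weakens the bound as M >= 1.
    With k >= 0 the power x^(-k) is decreasing and M <= A t can be inserted; k < e persists because
    e > 0.\<close>
  define k where "k = max 0 \<kappa>"
  have k: "k \<ge> 0" "e - k > 0"
    using \<open>\<not> e \<le> \<kappa>\<close> \<open>e > 0\<close> by (auto simp: k_def)
  define X where "X = B * A powr k / C"
  have X: "X > 0"
    using assms by (simp add: X_def)
  obtain \<alpha> t where G: "G \<alpha>" and t: "max 1 ((X + 1) powr (1 / (e - k))) \<le> t"
    and Mt: "M \<alpha> \<le> A * t" and dt: "d \<alpha> \<le> B * t powr (- e)"
    using family by blast
  have "t > 0"
    using t by auto
  have "C * (A * t) powr (- k) \<le> C * M \<alpha> powr (- k)"
    using Mt M1[OF G] k \<open>C > 0\<close> by (intro mult_left_mono powr_mono2') auto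
  also have "\<dots> \<le> C * M \<alpha> powr (- \<kappa>)"
    using M1[OF G] \<open>C > 0\<close> by (intro mult_left_mono powr_mono) (auto simp: k_def)
  also have "\<dots> \<le> B * t powr (- e)"
    using bound[OF G] dt by linarith
  finally have "C * (A powr (- k) * t powr (- k)) \<le> B * t powr (- e)"
    using \<open>A > 0\<close> \<open>t > 0\<close> by (simp add: powr_mult)
  then have "t powr (e - k) \<le> X"
    using \<open>A > 0\<close> \<open>t > 0\<close> \<open>C > 0\<close> \<open>B > 0\<close>
    by (simp add: X_def powr_diff powr_minus field_simps)
  moreover have "((X + 1) powr (1 / (e - k))) powr (e - k) \<le> t powr (e - k)"
    using t k by (intro powr_mono2) auto
  then have "X + 1 \<le> t powr (e - k)"
    using k X by (simp add: powr_powr)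
  ultimately show False
    by linarith
qed

text \<open>Dirichlet's theorem yields infinitely many reduced fractions h/r within 1/r^2 of
  \<theta>. The row (r, -h) is completed to a matrix of determinant 1.\<close>

lemma good_approximation_matrix:
  fixes \<theta> :: real
  assumes "\<theta> \<notin> \<rat>"
  obtains p q r s :: int where "p * s - q * r = 1" "r > 0" "K \<le> r" "0 \<le> p" "p \<le> r"
    "\<bar>r * \<theta> + s\<bar> \<le> 1 / r" "\<bar>p * \<theta> + q\<bar> \<le> 2 / r"
proof -
  have "infinite (approx_set \<theta>)"
    using assms rational_iff_finite_approx_set by blast
  then obtain h r where hr: "(h, r) \<in> approx_set \<theta>" "r > max 1 K"
    using infinite_approx_set by blast
  have cop: "coprime h r" and r: "r > 0" and approx: "\<bar>\<theta> - h / r\<bar> < 1 / r\<^sup>2"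
    using hr by (auto simp: approx_set_def)
  obtain x y where xy: "x * h + y * r = 1"
    using cop by (metis bezout_int coprime_imp_gcd_eq_1)
  define s where "s = - h"
  \<comment> \<open>Bezout gives the upper row (-x, -y). Subtracting a multiple of the lower row
    reduces its first entry modulo r and keeps the determinant.\<close>
  define p where "p = (- x) mod r"
  define q where "q = h * ((- x) div r) - y"
  have "x = - p - r * ((- x) div r)"
    using mult_div_mod_eq[of r "- x"] unfolding p_def by linarith
  then have "p * s - q * r = x * h + y * r"
    unfolding s_def q_def by algebra
  then have det: "p * s - q * r = 1"
    by (simp add: xy)
  have p: "0 \<le> p" "p \<le> r"
    using r by (auto simp: p_def intro: less_imp_le)
  have s\<theta>: "\<bar>r * \<theta> + s\<bar> \<le> 1 / r"
  proof -
    have "r * \<theta> + s = r * (\<theta> - h / r)"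
      using r by (simp add: s_def right_diff_distrib)
    then have "\<bar>r * \<theta> + s\<bar> = r * \<bar>\<theta> - h / r\<bar>"
      using r by (simp add: abs_mult)
    also have "\<dots> \<le> r * (1 / r\<^sup>2)"
      using approx r by (intro mult_left_mono) auto
    also have "\<dots> = 1 / r"
      using r by (simp add: power2_eq_square)
    finally show ?thesis .
  qed
  \<comment> \<open>The determinant relation expresses the numerator form by the denominator form:
    r(p\<theta> + q) = p(r\<theta> + s) - 1, at most 2 in absolute value because p <= r.\<close>
  have "r * (p * \<theta> + q) = p * (r * \<theta> + s) - (p * s - q * r)"
    by (simp add: algebra_simps)
  then have "r * (p * \<theta> + q) = p * (r * \<theta> + s) - 1"
    unfolding of_int_mult[symmetric] of_int_diff[symmetric] det by simp
  then have "\<bar>r * (p * \<theta> + q)\<bar> \<le> p * \<bar>r * \<theta> + s\<bar> + 1"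
    using p(1) abs_triangle_ineq4[of "p * (r * \<theta> + s)" 1] by (simp add: abs_mult)
  also have "\<dots> \<le> r * (1 / r) + 1"
    using p s\<theta> r by (intro add_right_mono mult_mono) auto
  finally have "r * \<bar>p * \<theta> + q\<bar> \<le> 2"
    using r by (simp add: abs_mult)
  then have "\<bar>p * \<theta> + q\<bar> \<le> 2 / r"
    using r by (simp add: pos_le_divide_eq mult.commute)
  with det r p s\<theta> hr show thesis
    by (intro that[of p s q r]) auto
qed

text \<open>The infimum is attained: e is an admissible exponent, with constant C, and no admissible
  \<kappa> lies below it.\<close>

lemma root_separation_exponent_eqI:
  fixes emb :: "nat \<Rightarrow> 'k::field_char_0 \<Rightarrow> complex"
  assumes "\<And>\<alpha>. (\<Prod>(i, j)\<in>{(i, j). i \<in> \<Sigma> \<and> j \<in> \<Sigma> \<and> i < j}. cmod (emb i \<alpha> - emb j \<alpha>)) = d \<alpha>"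
    and "C > 0" "\<And>\<alpha>. rat_adjoin \<alpha> = UNIV \<Longrightarrow> C * alg_mahler_measure \<alpha> powr (- e) \<le> d \<alpha>"
    and "\<And>\<kappa> C. C > 0 \<Longrightarrow>
      (\<And>\<alpha>. rat_adjoin \<alpha> = UNIV \<Longrightarrow> C * alg_mahler_measure \<alpha> powr (- \<kappa>) \<le> d \<alpha>) \<Longrightarrow> e \<le> \<kappa>"
  shows "root_separation_exponent emb \<Sigma> = ereal e"
  unfolding root_separation_exponent_def assms(1)
  by (rule Inf_eqI) (use assms(2-4) in auto)

lemma prod_increasing_pairs_2:
  fixes i j :: nat
  assumes "i \<noteq> j"
  shows "(\<Prod>(k, l)\<in>{(k, l). k \<in> {i, j} \<and> l \<in> {i, j} \<and> k < l}. cmod (f k - f l)) = cmod (f i - f j)"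
proof (cases "i < j")
  case True
  then have "{(k, l). k \<in> {i, j} \<and> l \<in> {i, j} \<and> k < l} = {(i, j)}"
    by auto
  then show ?thesis by simp
next
  case False
  then have "{(k, l). k \<in> {i, j} \<and> l \<in> {i, j} \<and> k < l} = {(j, i)}"
    using assms by auto
  then show ?thesis by (simp add: norm_minus_commute)
qed

lemma prod_increasing_pairs_123:
  "(\<Prod>(k, l)\<in>{(k, l). k \<in> {1, 2, 3} \<and> l \<in> {1, 2, 3} \<and> k < l}. cmod (f k - f l))
    = cmod (f 1 - f 2) * cmod (f 1 - f 3) * cmod (f 2 - f (3 :: nat))"
proof -
  have "{(k, l). k \<in> {1, 2, 3} \<and> l \<in> {1, 2, 3} \<and> k < l} = {(1, 2), (1, 3), (2, 3 :: nat)}"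
    by auto
  then show ?thesis by simp
qed

context cubic_field
begin

section \<open>Families of generators with close conjugates\<close>

lemma inverse_translate_family:
  obtains A B where "A > 0" "B > 0"
    "\<And>N. \<exists>\<beta> t. distinct_conj \<beta> \<and> N \<le> t \<and> 1 \<le> t \<and> alg_mahler_measure \<beta> \<le> A * t ^ 3 \<and>
      cmod (\<sigma> \<beta> - \<tau> \<beta>) \<le> B / t\<^sup>2 \<and> cmod (\<sigma> \<beta> - \<rho> \<beta>) \<le> B / t\<^sup>2 \<and> cmod (\<tau> \<beta> - \<rho> \<beta>) \<le> B / t\<^sup>2"
proof -
  obtain \<alpha> where \<alpha>: "distinct_conj \<alpha>"
    using generator_exists by blast
  define a where "a = real_of_int (alg_leading_coeff \<alpha>)"
  have a: "a \<ge> 1"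
    using alg_leading_coeff_ge_1[OF \<alpha>] by (simp add: a_def)
  define R where "R = cmod (\<sigma> \<alpha>) + cmod (\<tau> \<alpha>) + cmod (\<rho> \<alpha>)"
  have R: "cmod (\<phi> \<alpha>) \<le> R" if "field_embedding \<phi>" for \<phi>
  proof -
    have "\<phi> = \<sigma> \<or> \<phi> = \<tau> \<or> \<phi> = \<rho>"
      using that embeddings by blast
    then show ?thesis by (auto simp: R_def)
  qed
  have R0: "R \<ge> 0"
    by (simp add: R_def)
  \<comment> \<open>The constants come from a (2t)^3 = 8a t^3 and 2R/(t/2)^2 = 8R/t^2; the added 1
    makes B visibly positive.\<close>
  show thesis
  proof (rule that[of "8 * a" "8 * R + 1"])
    fix N :: real
    \<comment> \<open>For n >= 2R + 1 every conjugate has absolute value at most n/2, so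
      |\<phi>(\<alpha>) + n| lies between n/2 and 2n.\<close>
    define n where "n = nat \<lceil>max N (2 * R + 1)\<rceil>"
    define t where "t = real n"
    have t: "N \<le> t" "2 * R + 1 \<le> t"
      unfolding t_def n_def by linarith+
    have t1: "1 \<le> t"
      using t R0 by linarith
    define \<beta> where "\<beta> = moebius 0 (-1) 1 (int n) \<alpha>"
    have det: "0 * int n - (-1) * 1 = 1"
      by simp
    have upper: "cmod (\<phi> \<alpha> + of_int (int n)) \<le> 2 * t"
      and lower: "t / 2 \<le> cmod (\<phi> \<alpha> + of_int (int n))" if "field_embedding \<phi>" for \<phi>
      using R[OF that] t R0 norm_triangle_ineq[of "\<phi> \<alpha>" "of_nat n"]
        norm_diff_ineq[of "of_nat n" "\<phi> \<alpha>"]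
      by (auto simp: t_def add.commute)
    have diff: "cmod (\<phi> \<beta> - \<psi> \<beta>) \<le> (8 * R + 1) / t\<^sup>2"
      if "field_embedding \<phi>" "field_embedding \<psi>" for \<phi> \<psi>
    proof -
      have "cmod (\<phi> \<beta> - \<psi> \<beta>) = cmod (\<phi> \<alpha> - \<psi> \<alpha>) /
          (cmod (\<phi> \<alpha> + of_int (int n)) * cmod (\<psi> \<alpha> + of_int (int n)))"
        unfolding \<beta>_def moebius_diff[OF \<alpha> det that] by (simp add: norm_divide norm_mult)
      also have "\<dots> \<le> (2 * R) / (t / 2 * (t / 2))"
        using R[OF that(1)] R[OF that(2)] norm_triangle_ineq4[of "\<phi> \<alpha>" "\<psi> \<alpha>"]
          lower[OF that(1)] lower[OF that(2)] t1 R0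
        by (intro frac_le mult_mono mult_pos_pos) auto
      also have "\<dots> \<le> (8 * R + 1) / t\<^sup>2"
        using t1 by (simp add: field_simps power2_eq_square)
      finally show ?thesis .
    qed
    define h where "h = (\<lambda>\<phi>. max (cmod (of_int 1 * \<phi> \<alpha> + of_int (int n)))
      (cmod (of_int 0 * \<phi> \<alpha> + of_int (-1))))"
    have h: "0 \<le> h \<phi>" "h \<phi> \<le> 2 * t" if "field_embedding \<phi>" for \<phi>
      using upper[OF that] t1 by (auto simp: h_def)
    have "alg_mahler_measure \<beta> \<le> a * (h \<sigma> * h \<tau> * h \<rho>)"
      unfolding \<beta>_def a_def h_def by (rule mahler_moebius_le[OF \<alpha> det])
    also have "\<dots> \<le> a * ((2 * t) * (2 * t) * (2 * t))"
      using h[OF emb_\<sigma>] h[OF emb_\<tau>] h[OF emb_\<rho>] a t1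
      by (intro mult_left_mono mult_mono mult_nonneg_nonneg) auto
    also have "\<dots> = 8 * a * t ^ 3"
      by (simp add: power3_eq_cube)
    finally have "alg_mahler_measure \<beta> \<le> 8 * a * t ^ 3" .
    moreover have "distinct_conj \<beta>"
      unfolding \<beta>_def by (rule distinct_conj_moebius[OF \<alpha> det])
    ultimately show "\<exists>\<beta> t. distinct_conj \<beta> \<and> N \<le> t \<and> 1 \<le> t \<and>
      alg_mahler_measure \<beta> \<le> 8 * a * t ^ 3 \<and> cmod (\<sigma> \<beta> - \<tau> \<beta>) \<le> (8 * R + 1) / t\<^sup>2 \<and>
      cmod (\<sigma> \<beta> - \<rho> \<beta>) \<le> (8 * R + 1) / t\<^sup>2 \<and> cmod (\<tau> \<beta> - \<rho> \<beta>) \<le> (8 * R + 1) / t\<^sup>2"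
      using t(1) t1 diff emb_\<sigma> emb_\<tau> emb_\<rho> by blast
  qed (use a R0 in auto)
qed

text \<open>A rational value u/v would make the nonzero form v\<rho>(\<alpha>) - u vanish.
  Irrationality is what supplies infinitely many good approximations.\<close>

lemma real_conjugate_irrational:
  assumes "distinct_conj \<alpha>" "\<rho> \<alpha> = of_real \<theta>"
  shows "\<theta> \<notin> \<rat>"
proof
  assume "\<theta> \<in> \<rat>"
  then obtain u v :: int where uv: "v > 0" "\<theta> = of_int u / of_int v"
    by (meson Rats_cases')
  then have "of_int v * \<rho> \<alpha> + of_int (- u) = 0"
    by (simp add: assms(2))
  moreover have "of_int v * \<rho> \<alpha> + of_int (- u) \<noteq> 0"
    by (rule linear_form_nz[OF assms(1) emb_\<rho>]) (use uv in simp)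
  ultimately show False by blast
qed

text \<open>
  If \<open>r\<rho>(\<alpha>) + s\<close> and \<open>p\<rho>(\<alpha>) + q\<close> are of order \<open>1/r\<close>, the factor of \<open>\<rho>\<close> cancels one of the two
  factors \<open>r\<close> in the Mahler measure, while \<open>\<sigma>\<close> and \<open>\<tau>\<close> are still pushed together by \<open>r\<^sup>2\<close>.
\<close>

lemma approximation_family:
  assumes "real_embedding \<rho>"
  obtains A B where "A > 0" "B > 0"
    "\<And>N. \<exists>\<beta> t. distinct_conj \<beta> \<and> N \<le> t \<and> 1 \<le> t \<and> alg_mahler_measure \<beta> \<le> A * t \<and>
      cmod (\<sigma> \<beta> - \<tau> \<beta>) \<le> B / t\<^sup>2"
proof -
  obtain \<alpha> where \<alpha>: "distinct_conj \<alpha>"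
    using generator_exists by blast
  obtain \<theta> where \<theta>: "\<rho> \<alpha> = of_real \<theta>"
    using assms by (auto simp: real_embedding_def elim: Reals_cases)
  define a where "a = real_of_int (alg_leading_coeff \<alpha>)"
  have a: "a \<ge> 1"
    using alg_leading_coeff_ge_1[OF \<alpha>] by (simp add: a_def)
  \<comment> \<open>The other two conjugates have distance between c > 0 and D from
    \<theta>.\<close>
  define c where "c = min (cmod (\<sigma> \<alpha> - \<theta>)) (cmod (\<tau> \<alpha> - \<theta>))"
  define D where "D = max (cmod (\<sigma> \<alpha> - \<theta>)) (cmod (\<tau> \<alpha> - \<theta>))"
  define w where "w = cmod (\<sigma> \<alpha> - \<tau> \<alpha>)"
  have c: "c > 0" and w: "w > 0" and D: "D \<ge> 0"
    using \<alpha> by (auto simp: c_def w_def D_def distinct_conj_def \<theta> le_max_iff_disj)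
  have cD: "c \<le> cmod (\<phi> \<alpha> - \<theta>)" "cmod (\<phi> \<alpha> - \<theta>) \<le> D" if "\<phi> = \<sigma> \<or> \<phi> = \<tau>" for \<phi>
    using that by (auto simp: c_def D_def)
  \<comment> \<open>The constants come from a ((D + 2)t)^2 (2/t) and w/(tc/2)^2.\<close>
  show thesis
  proof (rule that[of "2 * a * (D + 2)\<^sup>2" "4 * w / c\<^sup>2"])
    fix N :: real
    \<comment> \<open>With r >= 2/c the error 1/t is at most tc/2. In r\<phi>(\<alpha>) + s it takes
      away at most half of the main term r(\<phi>(\<alpha>) - \<theta>), whose size is at least
      tc.\<close>
    obtain p q r s :: int where det: "p * s - q * r = 1" and r: "r > 0" "\<lceil>max N (2 / c)\<rceil> \<le> r"
      and p: "0 \<le> p" "p \<le> r"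
      and app: "\<bar>r * \<theta> + s\<bar> \<le> 1 / r" "\<bar>p * \<theta> + q\<bar> \<le> 2 / r"
      using good_approximation_matrix[OF real_conjugate_irrational[OF \<alpha> \<theta>]] .
    define t where "t = real_of_int r"
    have t: "N \<le> t" "2 / c \<le> t" "1 \<le> t"
      using r unfolding t_def by linarith+
    have ct: "1 / t \<le> t * c / 2" and t1: "1 / t \<le> t" "2 / t \<le> 2 * t"
    proof -
      have "1 / t \<le> 1" using t by simp
      moreover have "1 \<le> t * c / 2" using t c by (simp add: field_simps)
      ultimately show "1 / t \<le> t * c / 2" "1 / t \<le> t" "2 / t \<le> 2 * t"
        using t by (linarith, linarith, simp add: field_simps)
          (smt (verit) mult_le_cancel_left1)
    qed
    define \<beta> where "\<beta> = moebius p q r s \<alpha>"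
    have l\<theta>: "cmod (of_int r * of_real \<theta> + of_int s) \<le> 1 / t"
      and n\<theta>: "cmod (of_int p * of_real \<theta> + of_int q) \<le> 2 / t"
    proof -
      have "of_int r * of_real \<theta> + of_int s = complex_of_real (r * \<theta> + s)"
        "of_int p * of_real \<theta> + of_int q = complex_of_real (p * \<theta> + q)"
        by simp_all
      with app show "cmod (of_int r * of_real \<theta> + of_int s) \<le> 1 / t"
        "cmod (of_int p * of_real \<theta> + of_int q) \<le> 2 / t"
        unfolding t_def by (metis norm_of_real)+
    qed
    have l: "of_int r * \<phi> \<alpha> + of_int s = of_int r * (\<phi> \<alpha> - \<theta>) + (of_int r * of_real \<theta> + of_int s)"
      and n: "of_int p * \<phi> \<alpha> + of_int q = of_int p * (\<phi> \<alpha> - \<theta>) + (of_int p * of_real \<theta> + of_int q)"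
      for \<phi> :: "'k \<Rightarrow> complex"
      by (simp_all add: algebra_simps)
    have lower: "t * c / 2 \<le> cmod (of_int r * \<phi> \<alpha> + of_int s)" if "\<phi> = \<sigma> \<or> \<phi> = \<tau>" for \<phi>
    proof -
      have "t * c \<le> cmod (of_int r * (\<phi> \<alpha> - \<theta>))"
        using cD[OF that] r by (simp add: t_def norm_mult)
      then show ?thesis
        unfolding l[of \<phi>] using l\<theta> ct norm_diff_ineq[of "of_int r * (\<phi> \<alpha> - \<theta>)"
          "of_int r * of_real \<theta> + of_int s"] by linarith
    qed
    define h where
      "h = (\<lambda>\<phi>. max (cmod (of_int r * \<phi> \<alpha> + of_int s)) (cmod (of_int p * \<phi> \<alpha> + of_int q)))"
    have h0: "0 \<le> h \<phi>" for \<phi>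
      by (simp add: h_def le_max_iff_disj)
    have h: "h \<phi> \<le> (D + 2) * t" if "\<phi> = \<sigma> \<or> \<phi> = \<tau>" for \<phi>
    proof -
      have "cmod (of_int r * (\<phi> \<alpha> - \<theta>)) \<le> t * D"
        using cD[OF that] r by (simp add: t_def norm_mult)
      moreover have "cmod (of_int p * (\<phi> \<alpha> - \<theta>)) \<le> t * D"
        using cD[OF that] p r by (simp add: t_def norm_mult mult_mono)
      ultimately have "cmod (of_int r * \<phi> \<alpha> + of_int s) \<le> t * D + 1 / t"
        "cmod (of_int p * \<phi> \<alpha> + of_int q) \<le> t * D + 2 / t"
        unfolding l[of \<phi>] n[of \<phi>] using l\<theta> n\<theta> norm_triangle_le add_mono by blast+
      then show ?thesis
        unfolding h_def using t1 t(3) by (simp add: algebra_simps)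
    qed
    have h\<rho>: "h \<rho> \<le> 2 / t"
    proof -
      have "1 / t \<le> 2 / t"
        using t by (simp add: divide_right_mono)
      with l\<theta> n\<theta> show ?thesis
        unfolding h_def \<theta> by simp
    qed
    have "alg_mahler_measure \<beta> \<le> a * (h \<sigma> * h \<tau> * h \<rho>)"
      unfolding \<beta>_def a_def h_def by (rule mahler_moebius_le[OF \<alpha> det])
    also have "\<dots> \<le> a * (((D + 2) * t) * ((D + 2) * t) * (2 / t))"
      using h h0 h\<rho> a t D by (intro mult_left_mono mult_mono mult_nonneg_nonneg) auto
    also have "\<dots> = 2 * a * (D + 2)\<^sup>2 * t"
      using t by (simp add: power2_eq_square)
    finally have M: "alg_mahler_measure \<beta> \<le> 2 * a * (D + 2)\<^sup>2 * t" .
    have "cmod (\<sigma> \<beta> - \<tau> \<beta>) =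
        w / (cmod (of_int r * \<sigma> \<alpha> + of_int s) * cmod (of_int r * \<tau> \<alpha> + of_int s))"
      unfolding \<beta>_def moebius_diff[OF \<alpha> det emb_\<sigma> emb_\<tau>] by (simp add: norm_divide norm_mult w_def)
    also have "\<dots> \<le> w / ((t * c / 2) * (t * c / 2))"
      using lower w t c by (intro frac_le mult_mono mult_pos_pos) auto
    also have "\<dots> = 4 * w / c\<^sup>2 / t\<^sup>2"
      by (simp add: power2_eq_square field_simps)
    finally show "\<exists>\<beta> t. distinct_conj \<beta> \<and> N \<le> t \<and> 1 \<le> t \<and>
      alg_mahler_measure \<beta> \<le> 2 * a * (D + 2)\<^sup>2 * t \<and> cmod (\<sigma> \<beta> - \<tau> \<beta>) \<le> 4 * w / c\<^sup>2 / t\<^sup>2"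
      using M t distinct_conj_moebius[OF \<alpha> det] unfolding \<beta>_def by blast
  qed (use a c w D in auto)
qed

section \<open>Lower bounds for the exponents\<close>

lemma exponent_all_ge_2:
  assumes "C > 0" "\<And>\<alpha>. distinct_conj \<alpha> \<Longrightarrow> C * alg_mahler_measure \<alpha> powr (- \<kappa>) \<le>
    cmod (\<sigma> \<alpha> - \<tau> \<alpha>) * cmod (\<sigma> \<alpha> - \<rho> \<alpha>) * cmod (\<tau> \<alpha> - \<rho> \<alpha>)"
  shows "2 \<le> \<kappa>"
proof -
  obtain A B where AB: "A > 0" "B > 0" and family:
    "\<And>N. \<exists>\<beta> t. distinct_conj \<beta> \<and> N \<le> t \<and> 1 \<le> t \<and> alg_mahler_measure \<beta> \<le> A * t ^ 3 \<and>
      cmod (\<sigma> \<beta> - \<tau> \<beta>) \<le> B / t\<^sup>2 \<and> cmod (\<sigma> \<beta> - \<rho> \<beta>) \<le> B / t\<^sup>2 \<and> cmod (\<tau> \<beta> - \<rho> \<beta>) \<le> B / t\<^sup>2"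
    using inverse_translate_family by blast
  \<comment> \<open>The new parameter is t^3, the order of the Mahler measure; three differences of
    order t^(-2) multiply to (t^3)^(-2).\<close>
  have "\<exists>\<alpha> t. distinct_conj \<alpha> \<and> N \<le> t \<and> alg_mahler_measure \<alpha> \<le> A * t \<and>
    cmod (\<sigma> \<alpha> - \<tau> \<alpha>) * cmod (\<sigma> \<alpha> - \<rho> \<alpha>) * cmod (\<tau> \<alpha> - \<rho> \<alpha>) \<le> B ^ 3 * t powr (-2)" for N
  proof -
    obtain \<beta> t where \<beta>: "distinct_conj \<beta>" "N \<le> t" "1 \<le> t" "alg_mahler_measure \<beta> \<le> A * t ^ 3"
      "cmod (\<sigma> \<beta> - \<tau> \<beta>) \<le> B / t\<^sup>2" "cmod (\<sigma> \<beta> - \<rho> \<beta>) \<le> B / t\<^sup>2" "cmod (\<tau> \<beta> - \<rho> \<beta>) \<le> B / t\<^sup>2"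
      using family by blast
    have "t \<le> t ^ 3"
      using \<beta>(3) by (simp add: self_le_power)
    moreover have "cmod (\<sigma> \<beta> - \<tau> \<beta>) * cmod (\<sigma> \<beta> - \<rho> \<beta>) * cmod (\<tau> \<beta> - \<rho> \<beta>)
        \<le> B / t\<^sup>2 * (B / t\<^sup>2) * (B / t\<^sup>2)"
      using \<beta> AB by (intro mult_mono mult_nonneg_nonneg) auto
    moreover have "B / t\<^sup>2 * (B / t\<^sup>2) * (B / t\<^sup>2) = B ^ 3 * (t ^ 3) powr (-2)"
      using \<beta>(3) by (simp add: powr_minus powr_realpow field_simps power2_eq_square power3_eq_cube)
    ultimately show ?thesis
      using \<beta> by (intro exI[of _ \<beta>] exI[of _ "t ^ 3"]) auto
  qed
  then show ?thesis
    using exponent_ge[where G = distinct_conj and M = alg_mahler_measure and \<kappa> = \<kappa> and e = 2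
        and A = A and B = "B ^ 3" and C = C and d = "\<lambda>\<alpha>. cmod (\<sigma> \<alpha> - \<tau> \<alpha>) * cmod (\<sigma> \<alpha> - \<rho> \<alpha>)
          * cmod (\<tau> \<alpha> - \<rho> \<alpha>)"] assms mahler_measure_ge_1 AB
    by simp
qed

text \<open>In the same family a single difference of order t^(-2) is of order T^(-2/3) in terms of
  T = t^3.\<close>

lemma exponent_pair_ge_two_thirds:
  assumes "C > 0"
    "\<And>\<alpha>. distinct_conj \<alpha> \<Longrightarrow> C * alg_mahler_measure \<alpha> powr (- \<kappa>) \<le> cmod (\<sigma> \<alpha> - \<tau> \<alpha>)"
  shows "2 / 3 \<le> \<kappa>"
proof -
  obtain A B where AB: "A > 0" "B > 0" and family:
    "\<And>N. \<exists>\<beta> t. distinct_conj \<beta> \<and> N \<le> t \<and> 1 \<le> t \<and> alg_mahler_measure \<beta> \<le> A * t ^ 3 \<and>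
      cmod (\<sigma> \<beta> - \<tau> \<beta>) \<le> B / t\<^sup>2 \<and> cmod (\<sigma> \<beta> - \<rho> \<beta>) \<le> B / t\<^sup>2 \<and> cmod (\<tau> \<beta> - \<rho> \<beta>) \<le> B / t\<^sup>2"
    using inverse_translate_family by blast
  have "\<exists>\<alpha> t. distinct_conj \<alpha> \<and> N \<le> t \<and> alg_mahler_measure \<alpha> \<le> A * t \<and>
    cmod (\<sigma> \<alpha> - \<tau> \<alpha>) \<le> B * t powr (-(2/3))" for N
  proof -
    obtain \<beta> t where \<beta>: "distinct_conj \<beta>" "N \<le> t" "1 \<le> t" "alg_mahler_measure \<beta> \<le> A * t ^ 3"
      "cmod (\<sigma> \<beta> - \<tau> \<beta>) \<le> B / t\<^sup>2"
      using family by blast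
    have "t \<le> t ^ 3"
      using \<beta>(3) by (simp add: self_le_power)
    moreover have "(t ^ 3) powr (-(2/3)) = t powr (-2)"
      using \<beta>(3) powr_powr[of t 3 "-(2/3)"] by (simp add: powr_numeral)
    then have "B / t\<^sup>2 = B * (t ^ 3) powr (-(2/3))"
      using \<beta>(3) by (simp add: powr_minus powr_realpow field_simps)
    ultimately show ?thesis
      using \<beta> by (intro exI[of _ \<beta>] exI[of _ "t ^ 3"]) auto
  qed
  then show ?thesis
    using exponent_ge[where G = distinct_conj and M = alg_mahler_measure and \<kappa> = \<kappa> and e = "2 / 3"
        and A = A and B = B and C = C and d = "\<lambda>\<alpha>. cmod (\<sigma> \<alpha> - \<tau> \<alpha>)"]
      assms mahler_measure_ge_1 AB
    by simp
qed

text \<open>The approximations to the real conjugate keep the measure of order t instead of t^3,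
  which raises the exponent from 2/3 to 2.\<close>

lemma exponent_pair_ge_2:
  assumes "real_embedding \<rho>" "C > 0"
    "\<And>\<alpha>. distinct_conj \<alpha> \<Longrightarrow> C * alg_mahler_measure \<alpha> powr (- \<kappa>) \<le> cmod (\<sigma> \<alpha> - \<tau> \<alpha>)"
  shows "2 \<le> \<kappa>"
proof -
  obtain A B where AB: "A > 0" "B > 0" and family:
    "\<And>N. \<exists>\<beta> t. distinct_conj \<beta> \<and> N \<le> t \<and> 1 \<le> t \<and> alg_mahler_measure \<beta> \<le> A * t \<and>
      cmod (\<sigma> \<beta> - \<tau> \<beta>) \<le> B / t\<^sup>2"
    using approximation_family[OF assms(1)] by blast
  have "\<exists>\<alpha> t. distinct_conj \<alpha> \<and> N \<le> t \<and> alg_mahler_measure \<alpha> \<le> A * t \<and>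
    cmod (\<sigma> \<alpha> - \<tau> \<alpha>) \<le> B * t powr (-2)" for N
  proof -
    obtain \<beta> t where \<beta>: "distinct_conj \<beta>" "N \<le> t" "1 \<le> t" "alg_mahler_measure \<beta> \<le> A * t"
      "cmod (\<sigma> \<beta> - \<tau> \<beta>) \<le> B / t\<^sup>2"
      using family by blast
    have "B / t\<^sup>2 = B * t powr (-2)"
      using \<beta>(3) by (simp add: powr_minus powr_realpow field_simps)
    with \<beta> show ?thesis by auto
  qed
  then show ?thesis
    using exponent_ge[where G = distinct_conj and M = alg_mahler_measure and \<kappa> = \<kappa> and e = 2
        and A = A and B = B and C = C and d = "\<lambda>\<alpha>. cmod (\<sigma> \<alpha> - \<tau> \<alpha>)"]
      assms mahler_measure_ge_1 AB
    by simp
qed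

text \<open>Complex conjugation permutes the three embeddings. It exchanges \<sigma> and \<tau>, so
  it fixes \<rho>.\<close>

lemma third_embedding_real:
  assumes "conjugate_embeddings \<sigma> \<tau>"
  shows "real_embedding \<rho>"
proof -
  have \<tau>: "\<tau> = (\<lambda>x. cnj (\<sigma> x))"
    using assms by (auto simp: conjugate_embeddings_def)
  have "(\<lambda>x. cnj (\<rho> x)) \<in> {\<sigma>, \<tau>, \<rho>}"
    using field_embedding_cnj[OF emb_\<rho>] embeddings by blast
  moreover have "\<tau> = \<rho>" if "(\<lambda>x. cnj (\<rho> x)) = \<sigma>"
    unfolding \<tau> that[symmetric] by simp
  moreover have "\<sigma> = \<rho>" if "(\<lambda>x. cnj (\<rho> x)) = \<tau>"
    using fun_cong[OF that] by (simp add: \<tau> fun_eq_iff)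
  ultimately have "(\<lambda>x. cnj (\<rho> x)) = \<rho>"
    using distinct by blast
  then have "cnj (\<rho> x) = \<rho> x" for x
    by (rule fun_cong)
  then show ?thesis
    using emb_\<rho> by (auto simp: real_embedding_def Reals_cnj_iff)
qed

text \<open>The conjugate of \<tau> is again an embedding. A nonreal value of \<tau> distinguishes
  it from both \<sigma> and \<tau>, so it is \<rho>.\<close>

lemma third_embedding_conjugate:
  assumes "real_embedding \<sigma>" "complex_embedding \<tau>"
  shows "\<rho> x = cnj (\<tau> x)"
proof -
  have "(\<lambda>x. cnj (\<tau> x)) \<in> {\<sigma>, \<tau>, \<rho>}"
    using field_embedding_cnj[OF emb_\<tau>] embeddings by blast
  moreover obtain y where y: "\<tau> y \<notin> \<real>"
    using assms(2) by (auto simp: complex_embedding_def)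
  have "cnj (\<tau> y) \<noteq> \<sigma> y"
    using assms(1) y by (metis Reals_cnj_iff complex_cnj_cnj range_subsetD real_embedding_def)
  then have "(\<lambda>x. cnj (\<tau> x)) \<noteq> \<sigma>"
    by auto
  moreover have "(\<lambda>x. cnj (\<tau> x)) \<noteq> \<tau>"
    using y by (metis Reals_cnj_iff)
  ultimately have "(\<lambda>x. cnj (\<tau> x)) = \<rho>"
    by blast
  then show ?thesis
    by (simp add: fun_eq_iff)
qed

end

section \<open>Ordering of the embeddings and the case distinction on \<Sigma>\<close>

lemma cubic_field_emb:
  fixes emb :: "nat \<Rightarrow> 'k::field_char_0 \<Rightarrow> complex"
  assumes "number_field_degree TYPE('k) = 3"
    and "bij_betw emb {1, 2, 3} {\<sigma>. field_embedding \<sigma>}"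
    and "{i, j, k} = {1, 2, 3}" "i \<noteq> j" "i \<noteq> k" "j \<noteq> k"
  shows "cubic_field (emb i) (emb j) (emb k)"
proof
  show "{\<phi>. field_embedding \<phi>} = {emb i, emb j, emb k}"
    using assms(2) unfolding bij_betw_def assms(3)[symmetric] by auto
  have "inj_on emb {i, j, k}"
    using assms(2) unfolding bij_betw_def assms(3)[symmetric] by auto
  with assms(4-6) show "emb i \<noteq> emb j" "emb i \<noteq> emb k" "emb j \<noteq> emb k"
    by (auto simp: inj_on_def)
qed (rule assms(1))

lemma third_index:
  fixes i j :: nat
  assumes "{i, j} \<subseteq> {1, 2, 3}" "i \<noteq> j"
  obtains k where "{i, j, k} = {1, 2, 3}" "i \<noteq> k" "j \<noteq> k"
proof -
  have "i \<in> {1, 2, 3}" "j \<in> {1, 2, 3}"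
    using assms(1) by auto
  \<comment> \<open>The missing index is 6 - i - j because 1 + 2 + 3 = 6.\<close>
  with assms(2) have "{i, j, 6 - i - j} = {1, 2, 3} \<and> i \<noteq> 6 - i - j \<and> j \<noteq> 6 - i - j"
    by (elim insertE emptyE) auto
  with that show thesis by blast
qed

theorem theorem1p1:
  fixes emb :: "nat \<Rightarrow> 'k::field_char_0 \<Rightarrow> complex"
    and \<Sigma> :: "nat set"
  assumes "number_field_degree TYPE('k) = 3"
    and "bij_betw emb {1, 2, 3} {\<sigma>. field_embedding \<sigma>}"
    and "\<Sigma> \<subseteq> {1, 2, 3}"
    and "card \<Sigma> \<ge> 2"
  shows "(\<Sigma> = {1, 2, 3} \<or>
          (totally_real TYPE('k) \<and> card \<Sigma> = 2) \<or>
          (\<exists>i j. \<Sigma> = {i, j} \<and> conjugate_embeddings (emb i) (emb j))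
            \<longrightarrow> root_separation_exponent emb \<Sigma> = ereal 2) \<and>
         ((\<exists>i j. \<Sigma> = {i, j} \<and> real_embedding (emb i) \<and> complex_embedding (emb j))
            \<longrightarrow> root_separation_exponent emb \<Sigma> = ereal (2 / 3))"
proof -
  note cubic = cubic_field_emb[OF assms(1,2)]
  have all: "root_separation_exponent emb {1, 2, 3} = ereal 2"
  proof -
    interpret cubic_field "emb 1" "emb 2" "emb 3"
      by (rule cubic) auto
    show ?thesis
      by (rule root_separation_exponent_eqI[OF prod_increasing_pairs_123, where C = 1])
        (use separation_all exponent_all_ge_2 in \<open>auto simp: generator_iff\<close>)
  qed
  \<comment> \<open>Totally real fields and complex conjugate pairs both lead here: in either case
    the embedding left out of the pair is real.\<close>
  have pair: "root_separation_exponent emb {i, j} = ereal 2"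
    if ijk: "{i, j, k} = {1, 2, 3}" "i \<noteq> j" "i \<noteq> k" "j \<noteq> k" and k: "real_embedding (emb k)" for i j k
  proof -
    interpret cubic_field "emb i" "emb j" "emb k"
      by (rule cubic[OF ijk])
    show ?thesis
      by (rule root_separation_exponent_eqI[OF prod_increasing_pairs_2[OF ijk(2)], where C = "1/4"])
        (use separation_pair exponent_pair_ge_2[OF k] in \<open>auto simp: generator_iff\<close>)
  qed
  have real_complex: "root_separation_exponent emb {i, j} = ereal (2 / 3)"
    if ijk: "{i, j, k} = {1, 2, 3}" "i \<noteq> j" "i \<noteq> k" "j \<noteq> k"
      and ij: "real_embedding (emb i)" "complex_embedding (emb j)" for i j k
  proof -
    interpret cubic_field "emb i" "emb j" "emb k"
      by (rule cubic[OF ijk])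
    have "emb i \<alpha> \<in> \<real>" for \<alpha>
      using ij(1) by (auto simp: real_embedding_def)
    then have "1 / 2 * alg_mahler_measure \<alpha> powr (-(2/3)) \<le> cmod (emb i \<alpha> - emb j \<alpha>)"
      if "distinct_conj \<alpha>" for \<alpha>
      using separation_real_complex[OF that] third_embedding_conjugate[OF ij] by blast
    then show ?thesis
      by (intro root_separation_exponent_eqI[OF prod_increasing_pairs_2[OF ijk(2)], where C = "1/2"])
        (use exponent_pair_ge_two_thirds in \<open>auto simp: generator_iff\<close>)
  qed
  show ?thesis
  proof (intro conjI impI)
    assume "\<Sigma> = {1, 2, 3} \<or> (totally_real TYPE('k) \<and> card \<Sigma> = 2) \<or>
      (\<exists>i j. \<Sigma> = {i, j} \<and> conjugate_embeddings (emb i) (emb j))"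
    then consider "\<Sigma> = {1, 2, 3}" | "totally_real TYPE('k)" "card \<Sigma> = 2"
      | i j where "\<Sigma> = {i, j}" "conjugate_embeddings (emb i) (emb j)"
      by blast
    then show "root_separation_exponent emb \<Sigma> = ereal 2"
    proof cases
      case 1
      with all show ?thesis by simp
    next
      case 2
      obtain i j where ij: "\<Sigma> = {i, j}" "i \<noteq> j"
        using 2(2) by (auto simp: card_2_iff)
      obtain k where k: "{i, j, k} = {1, 2, 3}" "i \<noteq> k" "j \<noteq> k"
        using third_index ij assms(3) by metis
      interpret cubic_field "emb i" "emb j" "emb k"
        by (rule cubic[OF k(1) ij(2) k(2,3)])
      have "real_embedding (emb k)"
        using 2(1) emb_\<rho> by (simp add: totally_real_def)
      with ij k show ?thesis
        using pair by metis
    next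
      case 3
      have "i \<noteq> j"
        using assms(4) 3(1) by auto
      then obtain k where k: "{i, j, k} = {1, 2, 3}" "i \<noteq> k" "j \<noteq> k"
        using third_index 3(1) assms(3) by metis
      interpret cubic_field "emb i" "emb j" "emb k"
        by (rule cubic[OF k(1) \<open>i \<noteq> j\<close> k(2,3)])
      show ?thesis
        unfolding 3(1) by (rule pair[OF k(1) \<open>i \<noteq> j\<close> k(2,3) third_embedding_real[OF 3(2)]])
    qed
  next
    assume "\<exists>i j. \<Sigma> = {i, j} \<and> real_embedding (emb i) \<and> complex_embedding (emb j)"
    then obtain i j where ij: "\<Sigma> = {i, j}" "real_embedding (emb i)" "complex_embedding (emb j)"
      by blast
    have "i \<noteq> j"
      using assms(4) ij(1) by auto
    then obtain k where k: "{i, j, k} = {1, 2, 3}" "i \<noteq> k" "j \<noteq> k"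
      using third_index ij(1) assms(3) by metis
    show "root_separation_exponent emb \<Sigma> = ereal (2 / 3)"
      unfolding ij(1) by (rule real_complex[OF k(1) \<open>i \<noteq> j\<close> k(2,3) ij(2,3)])
  qed
qed

end
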